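(* Let $A=\sigma(R)\langle x_1,\dots,x_n\rangle$ be a skew PBW extension of a ring $R$, with standard filtration $\{F_p(A)\}$ and associated graded ring $Gr(A)$. Let $\succeq$ be a monomial order on $Mon(A)$ and let $\succeq_{gr}$ be the monomial order on $Mon(Gr(A))$ defined by $\eta(x^\alpha)\succeq_{gr}\eta(x^\beta)\Leftrightarrow x^\alpha\succeq x^\beta$. Let $I\neq 0$ be a left ideal of $A$. Suppose that $\overline{\mathcal G}=\{G_j\}_{j\in J}$ is a Gröbner basis of $Gr(I)$ with respect to $\succeq_{gr}$ consisting of homogeneous elements, and for each $j\in J$ let $g_j\in I$ be a chosen element with $\eta(g_j)=G_j$. Then $\mathcal G:=\{g_j\}_{j\in J}$ is a Gröbner basis of $I$ with respect to $\succeq$.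
   Context: Rings are associative with $1$. A ring $A$ is a skew PBW extension of a ring $R$, written $A=\sigma(R)\langle x_1,\dots,x_n\rangle$, if: (i) $R\subseteq A$ (subring); (ii) $x_1,\dots,x_n\in A$ and $A$ is a free left $R$-module with basis $Mon(A)=\{x^\alpha=x_1^{\alpha_1}\cdots x_n^{\alpha_n}\mid \alpha\in\mathbb N^n\}$; (iii) for all $1\le i\le n$ and $r\in R\setminus\{0\}$ there is $c_{i,r}\in R\setminus\{0\}$ with $x_ir-c_{i,r}x_i\in R$; (iv) for all $1\le i,j\le n$ there is $c_{i,j}\in R\setminus\{0\}$ with $x_jx_i-c_{i,j}x_ix_j\in R+Rx_1+\cdots+Rx_n$. Put $\deg(x^\alpha)=|\alpha|=\alpha_1+\dots+\alpha_n$, $\exp(x^\alpha)=\alpha$, and for $0\ne f\in A$ let $\deg(f)$ be the maximal degree of the monomials occurring in $f$ with nonzero coefficient. Known facts defining $\sigma^\alpha$ and $c_{\alpha,\beta}$: for $\alpha\in\mathbb N^n$, $0\ne r\in R$ there are unique $\sigma^\alpha(r)\in R\setminus\{0\}$ and $p_{\alpha,r}\in A$ with $x^\alpha r=\sigma^\alpha(r)x^\alpha+p_{\alpha,r}$ and $p_{\alpha,r}=0$ or $\deg(p_{\alpha,r})<|\alpha|$; for $\alpha,\beta\in\mathbb N^n$ there are unique $c_{\alpha,\beta}\in R$ (left invertible) and $p_{\alpha,\beta}\in A$ with $x^\alpha x^\beta=c_{\alpha,\beta}x^{\alpha+\beta}+p_{\alpha,\beta}$ and $p_{\alpha,\beta}=0$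 or $\deg(p_{\alpha,\beta})<|\alpha+\beta|$. Filtration: $F_p(A)=0$ for $p\le -1$, $F_0(A)=R$, $F_p(A)=\{f\in A\mid f=0\text{ or }\deg(f)\le p\}$ for $p\ge1$; $Gr(A)=\bigoplus_{p\ge0}Gr(A)_p$ with $Gr(A)_p=F_p(A)/F_{p-1}(A)$. For $0\ne f\in A$ with $\deg(f)=p$, the principal symbol is $\eta(f)=f+F_{p-1}(A)\in Gr(A)_p$. It is known that $Gr(A)$ is again a skew PBW extension of $R$ in the variables $\eta(x_1),\dots,\eta(x_n)$, with left $R$-basis of standard monomials $Mon(Gr(A))=\{\eta(x^\alpha)=\eta(x_1)^{\alpha_1}\cdots\eta(x_n)^{\alpha_n}\}$, so all the notions here apply to $Gr(A)$ as well. A monomial order on $Mon(A)$ is a total order $\succeq$ such that: (i) $x^\beta\succeq x^\alpha$ implies $lm(x^\gamma x^\beta x^\lambda)\succeq lm(x^\gamma x^\alpha x^\lambda)$ for all $x^\gamma,x^\lambda\in Mon(A)$; (ii) $x^\alpha\succeq 1$ for all $\alpha$; (iii) $|\beta|>|\alpha|$ implies $x^\beta\succ x^\alpha$. Here $lm(f)$ is the $\succeq$-largest monomial occurring in $f\neq0$, and $lc(f)\in R\setminus\{0\}$ is its coefficient. For a left ideal $I$ of $A$, $Gr(I)=\bigoplus_{p\ge0}Gr(I)_p$ with $Gr(I)_p=(I\cap F_p(A))/(I\cap F_{p-1}(A))\cong ((I+F_{p-1}(A))\cap F_p(A))/F_{p-1}(A)$, viewed as a left ideal of $Gr(A)$.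 Gröbner basis: let $I\ne0$ be a left ideal of $A$ and $G$ a nonempty finite set of nonzero elements of $I$. $G$ is a Gröbner basis of $I$ if every $0\ne f\in I$ is reducible with respect to $G$, i.e. there exist $g_1,\dots,g_t\in G$ and $\alpha_1,\dots,\alpha_t\in\mathbb N^n$ with $\alpha_j+\exp(lm(g_j))=\exp(lm(f))$ for all $j$ (that is, $lm(g_j)\mid lm(f)$) and $lc(f)$ lies in the left ideal of $R$ generated by $\sigma^{\alpha_1}(lc(g_1))c_{\alpha_1,g_1},\dots,\sigma^{\alpha_t}(lc(g_t))c_{\alpha_t,g_t}$, where $c_{\alpha,g}:=c_{\alpha,\exp(lm(g))}$. *)

theory Defs
  imports "HOL-Algebra.QuotRing" "HOL-Algebra.Subrings"
begin

section \<open>Left ideals\<close>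

definition left_ideal :: "'a set \<Rightarrow> ('a, 'm) ring_scheme \<Rightarrow> bool" where
  "left_ideal I A \<longleftrightarrow>
     additive_subgroup I A \<and> (\<forall>a\<in>carrier A. \<forall>u\<in>I. a \<otimes>\<^bsub>A\<^esub> u \<in> I)"

definition gen_left_ideal :: "('a, 'm) ring_scheme \<Rightarrow> 'a set \<Rightarrow> 'a set" where
  "gen_left_ideal A S = \<Inter>{I. left_ideal I A \<and> S \<subseteq> I}"


section \<open>Skew PBW extensions\<close>

text \<open>
  A ring \<open>A\<close> together with a subset \<open>base A\<close> (the ring \<open>R\<close>) and the variables
  \<open>var A 0, \<dots>, var A (nvars A - 1)\<close>. The variables are thus numbered from \<open>0\<close>, and
  \<open>var A i\<close> is irrelevant for \<open>i \<ge> nvars A\<close>.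
\<close>
record 'a pbw = "'a ring" +
  base :: "'a set"
  nvars :: nat
  var :: "nat \<Rightarrow> 'a"

text \<open>Elements of \<open>\<nat>\<^sup>n\<close> are functions on \<open>nat\<close> that vanish from \<open>n\<close> on.\<close>
definition exponents :: "('a, 'm) pbw_scheme \<Rightarrow> (nat \<Rightarrow> nat) set" where
  "exponents A = {\<alpha>. \<forall>i\<ge>nvars A. \<alpha> i = 0}"

definition exp_add :: "(nat \<Rightarrow> nat) \<Rightarrow> (nat \<Rightarrow> nat) \<Rightarrow> nat \<Rightarrow> nat" where
  "exp_add \<alpha> \<beta> = (\<lambda>i. \<alpha> i + \<beta> i)"

definition exp_size :: "('a, 'm) pbw_scheme \<Rightarrow> (nat \<Rightarrow> nat) \<Rightarrow> nat" where
  "exp_size A \<alpha> = (\<Sum>i<nvars A. \<alpha> i)"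

primrec var_prod :: "('a, 'm) pbw_scheme \<Rightarrow> (nat \<Rightarrow> nat) \<Rightarrow> nat \<Rightarrow> 'a" where
  "var_prod A \<alpha> 0 = \<one>\<^bsub>A\<^esub>"
| "var_prod A \<alpha> (Suc k) = var_prod A \<alpha> k \<otimes>\<^bsub>A\<^esub> (var A k [^]\<^bsub>A\<^esub> \<alpha> k)"

definition xpow :: "('a, 'm) pbw_scheme \<Rightarrow> (nat \<Rightarrow> nat) \<Rightarrow> 'a" where
  "xpow A \<alpha> = var_prod A \<alpha> (nvars A)"

definition Mon :: "('a, 'm) pbw_scheme \<Rightarrow> 'a set" where
  "Mon A = xpow A ` exponents A"

definition coeff_families :: "('a, 'm) pbw_scheme \<Rightarrow> ((nat \<Rightarrow> nat) \<Rightarrow> 'a) set" where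
  "coeff_families A =
     {c. (\<forall>\<alpha>. c \<alpha> \<in> base A) \<and> {\<alpha>. c \<alpha> \<noteq> \<zero>\<^bsub>A\<^esub>} \<subseteq> exponents A \<and> finite {\<alpha>. c \<alpha> \<noteq> \<zero>\<^bsub>A\<^esub>}}"

definition lincomb :: "('a, 'm) pbw_scheme \<Rightarrow> ((nat \<Rightarrow> nat) \<Rightarrow> 'a) \<Rightarrow> 'a" where
  "lincomb A c = (\<Oplus>\<^bsub>A\<^esub>\<alpha>\<in>{\<alpha>. c \<alpha> \<noteq> \<zero>\<^bsub>A\<^esub>}. c \<alpha> \<otimes>\<^bsub>A\<^esub> xpow A \<alpha>)"

text \<open>
  The basis \<open>(x\<^sup>\<alpha>)\<close> is understood as a family indexed by the exponents; in
  particular, distinct exponents give distinct monomials unless the ring is trivial.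
\<close>
locale skew_PBW = ring A for A :: "('a, 'm) pbw_scheme" (structure) +
  assumes base_subring: "subring (base A) A"
    and var_closed: "\<And>i. i < nvars A \<Longrightarrow> var A i \<in> carrier A"
    and Mon_basis: "\<And>f. f \<in> carrier A \<Longrightarrow> \<exists>!c. c \<in> coeff_families A \<and> f = lincomb A c"
    and var_base: "\<And>i r. \<lbrakk>i < nvars A; r \<in> base A - {\<zero>}\<rbrakk> \<Longrightarrow>
      \<exists>c\<in>base A - {\<zero>}. var A i \<otimes> r \<ominus> c \<otimes> var A i \<in> base A"
    and var_var: "\<And>i j. \<lbrakk>i < nvars A; j < nvars A\<rbrakk> \<Longrightarrow>
      \<exists>c\<in>base A - {\<zero>}. \<exists>r\<in>base A. \<exists>s\<in>{..<nvars A} \<rightarrow> base A.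
        var A j \<otimes> var A i \<ominus> c \<otimes> (var A i \<otimes> var A j) =
          r \<oplus> (\<Oplus>k\<in>{..<nvars A}. s k \<otimes> var A k)"


section \<open>Coefficients, degree, and the elements \<open>\<sigma>\<^sup>\<alpha>(r)\<close> and \<open>c\<^sub>\<alpha>\<^sub>,\<^sub>\<beta>\<close>\<close>

definition coeff_of :: "('a, 'm) pbw_scheme \<Rightarrow> 'a \<Rightarrow> (nat \<Rightarrow> nat) \<Rightarrow> 'a" where
  "coeff_of A f = (THE c. c \<in> coeff_families A \<and> f = lincomb A c)"

definition supp :: "('a, 'm) pbw_scheme \<Rightarrow> 'a \<Rightarrow> (nat \<Rightarrow> nat) set" where
  "supp A f = {\<alpha>. coeff_of A f \<alpha> \<noteq> \<zero>\<^bsub>A\<^esub>}"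

text \<open>Only meaningful for nonzero elements.\<close>
definition pdeg :: "('a, 'm) pbw_scheme \<Rightarrow> 'a \<Rightarrow> nat" where
  "pdeg A f = Max (exp_size A ` supp A f)"

definition mon_exp :: "('a, 'm) pbw_scheme \<Rightarrow> 'a \<Rightarrow> nat \<Rightarrow> nat" where
  "mon_exp A m = (THE \<alpha>. \<alpha> \<in> exponents A \<and> xpow A \<alpha> = m)"

text \<open>
  \<open>sigma A \<alpha> r\<close> is used for nonzero \<open>r\<close> only. That it is then nonzero, and that
  \<open>cmul A \<alpha> \<beta>\<close> is left invertible, is a consequence of the axioms of \<open>skew_PBW\<close>;
  these properties are not needed to single out the two elements.
\<close>
definition sigma :: "('a, 'm) pbw_scheme \<Rightarrow> (nat \<Rightarrow> nat) \<Rightarrow> 'a \<Rightarrow> 'a" where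
  "sigma A \<alpha> r = (THE s. s \<in> base A \<and> (\<exists>p\<in>carrier A.
     xpow A \<alpha> \<otimes>\<^bsub>A\<^esub> r = s \<otimes>\<^bsub>A\<^esub> xpow A \<alpha> \<oplus>\<^bsub>A\<^esub> p \<and>
     (p = \<zero>\<^bsub>A\<^esub> \<or> pdeg A p < exp_size A \<alpha>)))"

definition cmul :: "('a, 'm) pbw_scheme \<Rightarrow> (nat \<Rightarrow> nat) \<Rightarrow> (nat \<Rightarrow> nat) \<Rightarrow> 'a" where
  "cmul A \<alpha> \<beta> = (THE c. c \<in> base A \<and> (\<exists>p\<in>carrier A.
     xpow A \<alpha> \<otimes>\<^bsub>A\<^esub> xpow A \<beta> = c \<otimes>\<^bsub>A\<^esub> xpow A (exp_add \<alpha> \<beta>) \<oplus>\<^bsub>A\<^esub> p \<and>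
     (p = \<zero>\<^bsub>A\<^esub> \<or> pdeg A p < exp_size A (exp_add \<alpha> \<beta>))))"


section \<open>Monomial orders and Groebner bases\<close>

text \<open>
  An order on \<open>Mon A\<close> is a relation \<open>ord\<close> in which \<open>(u, v) \<in> ord\<close> means \<open>v \<succeq> u\<close>.
\<close>
definition lm :: "('a, 'm) pbw_scheme \<Rightarrow> 'a rel \<Rightarrow> 'a \<Rightarrow> 'a" where
  "lm A ord f = (THE m. m \<in> xpow A ` supp A f \<and> (\<forall>m'\<in>xpow A ` supp A f. (m', m) \<in> ord))"

definition lc :: "('a, 'm) pbw_scheme \<Rightarrow> 'a rel \<Rightarrow> 'a \<Rightarrow> 'a" where
  "lc A ord f = coeff_of A f (mon_exp A (lm A ord f))"

definition monomial_order :: "('a, 'm) pbw_scheme \<Rightarrow> 'a rel \<Rightarrow> bool" where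
  "monomial_order A ord \<longleftrightarrow>
     linear_order_on (Mon A) ord \<and>
     (\<forall>u v. (u, v) \<in> ord \<longrightarrow> (\<forall>s\<in>Mon A. \<forall>t\<in>Mon A.
        (lm A ord (s \<otimes>\<^bsub>A\<^esub> u \<otimes>\<^bsub>A\<^esub> t), lm A ord (s \<otimes>\<^bsub>A\<^esub> v \<otimes>\<^bsub>A\<^esub> t)) \<in> ord)) \<and>
     (\<forall>u\<in>Mon A. (\<one>\<^bsub>A\<^esub>, u) \<in> ord) \<and>
     (\<forall>\<alpha>\<in>exponents A. \<forall>\<beta>\<in>exponents A. exp_size A \<alpha> < exp_size A \<beta> \<longrightarrow>
        (xpow A \<alpha>, xpow A \<beta>) \<in> ord \<and> xpow A \<alpha> \<noteq> xpow A \<beta>)"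

definition reducible_wrt :: "('a, 'm) pbw_scheme \<Rightarrow> 'a rel \<Rightarrow> 'a set \<Rightarrow> 'a \<Rightarrow> bool" where
  "reducible_wrt A ord G f \<longleftrightarrow> (\<exists>(t::nat) g \<alpha>.
     (\<forall>j\<in>{1..t}. g j \<in> G \<and> \<alpha> j \<in> exponents A \<and>
        exp_add (\<alpha> j) (mon_exp A (lm A ord (g j))) = mon_exp A (lm A ord f)) \<and>
     lc A ord f \<in> gen_left_ideal (A\<lparr>carrier := base A\<rparr>)
       {sigma A (\<alpha> j) (lc A ord (g j)) \<otimes>\<^bsub>A\<^esub> cmul A (\<alpha> j) (mon_exp A (lm A ord (g j))) |j.
          j \<in> {1..t}})"

text \<open>To be used for nonzero left ideals \<open>I\<close>.\<close>
definition groebner_basis :: "('a, 'm) pbw_scheme \<Rightarrow> 'a rel \<Rightarrow> 'a set \<Rightarrow> 'a set \<Rightarrow> bool" where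
  "groebner_basis A ord I G \<longleftrightarrow>
     finite G \<and> G \<noteq> {} \<and> G \<subseteq> I - {\<zero>\<^bsub>A\<^esub>} \<and>
     (\<forall>f\<in>I - {\<zero>\<^bsub>A\<^esub>}. reducible_wrt A ord G f)"


section \<open>Standard filtration and associated graded ring\<close>

definition filt :: "('a, 'm) pbw_scheme \<Rightarrow> int \<Rightarrow> 'a set" where
  "filt A p =
     (if p < 0 then {\<zero>\<^bsub>A\<^esub>}
      else if p = 0 then base A
      else {f \<in> carrier A. f = \<zero>\<^bsub>A\<^esub> \<or> int (pdeg A f) \<le> p})"

text \<open>
  \<open>Gr(A)\<^sub>p\<close> as a quotient group; the library writes the factor group of the additive group
  multiplicatively.
\<close>
definition gr_comp :: "('a, 'm) pbw_scheme \<Rightarrow> nat \<Rightarrow> 'a set monoid" where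
  "gr_comp A p = (A\<lparr>carrier := filt A (int p)\<rparr>) A_Mod (filt A (int p - 1))"

definition in_degree :: "('a, 'm) pbw_scheme \<Rightarrow> nat \<Rightarrow> 'a set \<Rightarrow> nat \<Rightarrow> 'a set" where
  "in_degree A p X = (\<lambda>q. if q = p then X else \<one>\<^bsub>gr_comp A q\<^esub>)"

text \<open>The principal symbol \<open>\<eta>(f)\<close>; for \<open>f = 0\<close> this is the zero of \<open>Gr(A)\<close>.\<close>
definition symbol :: "('a, 'm) pbw_scheme \<Rightarrow> 'a \<Rightarrow> nat \<Rightarrow> 'a set" where
  "symbol A f = in_degree A (pdeg A f) (filt A (int (pdeg A f) - 1) +>\<^bsub>A\<^esub> f)"

text \<open>
  Elements of the direct sum are families of cosets almost all of which are trivial. The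
  product of \<open>a + F\<^bsub>i-1\<^esub>\<close> and \<open>b + F\<^bsub>j-1\<^esub>\<close> is \<open>ab + F\<^bsub>i+j-1\<^esub>\<close>, and
  \<open>finprod\<close> adds up the contributions with \<open>i + j = p\<close> in the group \<open>Gr(A)\<^sub>p\<close>.
  The base ring \<open>R\<close> is identified with its copy \<open>Gr(A)\<^sub>0 = R/0\<close> inside \<open>Gr(A)\<close>.
\<close>
definition gr :: "('a, 'm) pbw_scheme \<Rightarrow> (nat \<Rightarrow> 'a set) pbw" where
  "gr A =
     \<lparr>carrier = {u. (\<forall>p. u p \<in> carrier (gr_comp A p)) \<and> finite {p. u p \<noteq> \<one>\<^bsub>gr_comp A p\<^esub>}},
      mult = (\<lambda>u v p.
        finprod (gr_comp A p)
          (\<lambda>i. rcoset_mult A (filt A (int p - 1)) (u i) (v (p - i))) {..p}),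
      one = in_degree A 0 (filt A (-1) +>\<^bsub>A\<^esub> \<one>\<^bsub>A\<^esub>),
      zero = (\<lambda>p. \<one>\<^bsub>gr_comp A p\<^esub>),
      add = (\<lambda>u v p. u p \<otimes>\<^bsub>gr_comp A p\<^esub> v p),
      base = in_degree A 0 ` carrier (gr_comp A 0),
      nvars = nvars A,
      var = (\<lambda>i. symbol A (var A i))\<rparr>"

definition homogeneous :: "('a, 'm) pbw_scheme \<Rightarrow> (nat \<Rightarrow> 'a set) \<Rightarrow> bool" where
  "homogeneous A u \<longleftrightarrow> (\<exists>p. u \<in> in_degree A p ` carrier (gr_comp A p))"

text \<open>
  \<open>Gr(I)\<^sub>p\<close> is taken in the form \<open>((I + F\<^bsub>p-1\<^esub>) \<inter> F\<^sub>p) / F\<^bsub>p-1\<^esub>\<close>, which is literally a subset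
  of \<open>Gr(A)\<^sub>p\<close>.
\<close>
definition gr_ideal :: "('a, 'm) pbw_scheme \<Rightarrow> 'a set \<Rightarrow> (nat \<Rightarrow> 'a set) set" where
  "gr_ideal A I = {u \<in> carrier (gr A). \<forall>p.
     u p \<in> (\<lambda>f. filt A (int p - 1) +>\<^bsub>A\<^esub> f) `
       ((I <+>\<^bsub>A\<^esub> filt A (int p - 1)) \<inter> filt A (int p))}"

definition gr_order :: "('a, 'm) pbw_scheme \<Rightarrow> 'a rel \<Rightarrow> (nat \<Rightarrow> 'a set) rel" where
  "gr_order A ord = {(symbol A u, symbol A v) |u v. (u, v) \<in> ord}"

end

theory Submission
  imports Defs
begin

text \<open>
  Rewriting with the commutation rules shows that the standard filtration is multiplicative and
  that \<open>x\<^sup>\<alpha> r x\<^sup>\<beta>\<close> is a multiple of \<open>x\<^bsup>\<alpha>+\<beta>\<^esup>\<close> modulo lower degree. Hence \<open>Gr(A)\<close> has the basis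
  \<open>\<eta>(x\<^sup>\<alpha>)\<close> over \<open>R\<close>, and the coefficients \<open>\<sigma>\<^sup>\<alpha>(r)\<close> and \<open>c\<^sub>\<alpha>\<^sub>,\<^sub>\<beta>\<close> are the same in \<open>A\<close> and in \<open>Gr(A)\<close>.
  As a monomial order refines the degree, \<open>f\<close> and \<open>\<eta>(f)\<close> have the same leading exponent
  and the same leading coefficient, so a reduction of \<open>\<eta>(f)\<close> by the \<open>\<eta>(g\<^sub>j)\<close> is literally
  a reduction of \<open>f\<close> by the \<open>g\<^sub>j\<close>.
\<close>

section \<open>Multiplicativity of the standard filtration\<close>

text \<open>Everything about Gr(A) is computed with the elements \<open>gr_elem A p f\<close>, the
  class of \<open>f\<close> placed in degree \<open>p\<close>: they multiply like their
  representatives, and the notions for Gr(A) are then evaluated straight from their definite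
  descriptions. The obstacle in the rewriting is the remainders. Commuting one variable past another
  leaves terms of lower degree which must themselves be brought to standard form, so the induction
  on the degree has to yield a statement about whole filtration levels and not only about monomials.
  The assumption 1 \<noteq> 0 appears with the symbols of monomials. In the trivial ring every
  support is empty and the degree is an unspecified \<open>Max {}\<close>, so the variables of Gr(A)
  would sit in an unspecified degree. A nonzero left ideal excludes this ring.\<close>

context skew_PBW
begin

section \<open>Coefficients with respect to the monomial basis\<close>

lemma base_closed: "r \<in> base A \<Longrightarrow> r \<in> carrier A"
  using subringE(1)[OF base_subring] by blast

lemmas base_zero = subringE(2)[OF base_subring]
lemmas base_one = subringE(3)[OF base_subring]
lemmas base_minus = subringE(5)[OF base_subring]
lemmas base_mult = subringE(6)[OF base_subring]
lemmas base_add = subringE(7)[OF base_subring]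

lemma var_prod_closed: "k \<le> nvars A \<Longrightarrow> var_prod A \<alpha> k \<in> carrier A"
  by (induction k) (auto intro!: m_closed nat_pow_closed var_closed)

lemma xpow_closed: "xpow A \<alpha> \<in> carrier A"
  unfolding xpow_def by (rule var_prod_closed) simp

lemma coeff_of_lincomb:
  assumes "c \<in> coeff_families A" shows "coeff_of A (lincomb A c) = c"
proof -
  have "lincomb A c \<in> carrier A"
    unfolding lincomb_def
    by (rule finsum_closed) (use assms xpow_closed base_closed in \<open>auto simp: coeff_families_def\<close>)
  from Mon_basis[OF this] show ?thesis
    unfolding coeff_of_def using assms by (intro the1_equality) auto
qed

lemma coeff_of:
  assumes "f \<in> carrier A"
  shows coeff_of_family: "coeff_of A f \<in> coeff_families A"
    and lincomb_coeff_of: "lincomb A (coeff_of A f) = f"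
  using theI'[OF Mon_basis[OF assms]] unfolding coeff_of_def by auto

lemma coeff_of_base: "f \<in> carrier A \<Longrightarrow> coeff_of A f \<alpha> \<in> base A"
  using coeff_of_family by (auto simp: coeff_families_def)

lemma coeff_of_closed: "f \<in> carrier A \<Longrightarrow> coeff_of A f \<alpha> \<in> carrier A"
  using coeff_of_base base_closed by blast

lemma supp_exponents: "f \<in> carrier A \<Longrightarrow> supp A f \<subseteq> exponents A"
  using coeff_of_family by (auto simp: coeff_families_def supp_def)

lemma finite_supp: "f \<in> carrier A \<Longrightarrow> finite (supp A f)"
  using coeff_of_family by (auto simp: coeff_families_def supp_def)

text \<open>Families with different supports can thus be summed over one common finite index set;
  the added terms are zero.\<close>

lemma lincomb_superset:
  assumes "finite S" "{\<alpha>. c \<alpha> \<noteq> \<zero>} \<subseteq> S" "\<And>\<alpha>. c \<alpha> \<in> base A"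
  shows "lincomb A c = (\<Oplus>\<alpha>\<in>S. c \<alpha> \<otimes> xpow A \<alpha>)"
  unfolding lincomb_def
  by (rule add.finprod_mono_neutral_cong_left) (use assms xpow_closed base_closed in auto)

lemma coeff_familiesD:
  assumes "c \<in> coeff_families A"
  shows "c \<alpha> \<in> base A" "c \<alpha> \<noteq> \<zero> \<Longrightarrow> \<alpha> \<in> exponents A" "finite {\<alpha>. c \<alpha> \<noteq> \<zero>}"
  using assms by (auto simp: coeff_families_def)

lemma lincomb_closed: "c \<in> coeff_families A \<Longrightarrow> lincomb A c \<in> carrier A"
  unfolding lincomb_def
  by (rule finsum_closed) (use xpow_closed base_closed in \<open>auto simp: coeff_families_def\<close>)

lemma lincomb_add:
  assumes c: "c \<in> coeff_families A" and d: "d \<in> coeff_families A"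
  shows "(\<lambda>\<alpha>. c \<alpha> \<oplus> d \<alpha>) \<in> coeff_families A"
    and "lincomb A (\<lambda>\<alpha>. c \<alpha> \<oplus> d \<alpha>) = lincomb A c \<oplus> lincomb A d"
proof -
  let ?S = "{\<alpha>. c \<alpha> \<noteq> \<zero>} \<union> {\<alpha>. d \<alpha> \<noteq> \<zero>}"
  have fin: "finite ?S" using c d by (auto simp: coeff_families_def)
  have sub: "{\<alpha>. c \<alpha> \<oplus> d \<alpha> \<noteq> \<zero>} \<subseteq> ?S" by auto
  show "(\<lambda>\<alpha>. c \<alpha> \<oplus> d \<alpha>) \<in> coeff_families A"
    using c d sub finite_subset[OF sub fin] base_add
    by (auto simp: coeff_families_def)
  show "lincomb A (\<lambda>\<alpha>. c \<alpha> \<oplus> d \<alpha>) = lincomb A c \<oplus> lincomb A d"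
    using fin sub coeff_familiesD(1)[OF c] coeff_familiesD(1)[OF d]
    by (subst (1 2 3) lincomb_superset[of ?S])
       (auto simp: base_add base_closed xpow_closed l_distr
             intro!: add.finprod_multf cong: add.finprod_cong)
qed

lemma lincomb_scale:
  assumes r: "r \<in> base A" and c: "c \<in> coeff_families A"
  shows "(\<lambda>\<alpha>. r \<otimes> c \<alpha>) \<in> coeff_families A"
    and "lincomb A (\<lambda>\<alpha>. r \<otimes> c \<alpha>) = r \<otimes> lincomb A c"
proof -
  let ?S = "{\<alpha>. c \<alpha> \<noteq> \<zero>}"
  have fin: "finite ?S" using c by (auto simp: coeff_families_def)
  have sub: "{\<alpha>. r \<otimes> c \<alpha> \<noteq> \<zero>} \<subseteq> ?S" using r base_closed by auto
  show "(\<lambda>\<alpha>. r \<otimes> c \<alpha>) \<in> coeff_families A"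
    using c r sub finite_subset[OF sub fin] base_mult
    by (auto simp: coeff_families_def)
  show "lincomb A (\<lambda>\<alpha>. r \<otimes> c \<alpha>) = r \<otimes> lincomb A c"
    using fin sub r coeff_familiesD(1)[OF c]
    by (subst (1 2) lincomb_superset[of ?S])
       (auto simp: base_mult base_closed xpow_closed m_assoc finsum_rdistr
             intro!: add.finprod_cong')
qed

text \<open>Uniqueness in the basis axiom: the pointwise sum is a coefficient family representing
  the sum, hence it is the coefficient family of the sum.\<close>

lemma coeff_of_add:
  assumes "f \<in> carrier A" "g \<in> carrier A"
  shows "coeff_of A (f \<oplus> g) \<alpha> = coeff_of A f \<alpha> \<oplus> coeff_of A g \<alpha>"
  using coeff_of_lincomb[OF lincomb_add(1)[OF assms[THEN coeff_of_family]]]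
    lincomb_add(2)[OF assms[THEN coeff_of_family]] assms[THEN lincomb_coeff_of]
  by simp

lemma coeff_of_scale:
  assumes "r \<in> base A" "f \<in> carrier A"
  shows "coeff_of A (r \<otimes> f) \<alpha> = r \<otimes> coeff_of A f \<alpha>"
  using coeff_of_lincomb[OF lincomb_scale(1)[OF assms(1) coeff_of_family[OF assms(2)]]]
    lincomb_scale(2)[OF assms(1) coeff_of_family[OF assms(2)]] lincomb_coeff_of[OF assms(2)]
  by simp

lemma coeff_of_zero: "coeff_of A \<zero> \<alpha> = \<zero>"
proof -
  have "(\<lambda>\<alpha>. \<zero>) \<in> coeff_families A" using base_zero by (auto simp: coeff_families_def)
  moreover have "lincomb A (\<lambda>\<alpha>. \<zero>) = \<zero>" by (simp add: lincomb_def)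
  ultimately show ?thesis using coeff_of_lincomb by metis
qed

lemma coeff_of_monomial:
  assumes "r \<in> base A" "\<alpha> \<in> exponents A"
  shows "coeff_of A (r \<otimes> xpow A \<alpha>) = (\<lambda>\<beta>. if \<beta> = \<alpha> then r else \<zero>)"
proof -
  let ?c = "\<lambda>\<beta>. if \<beta> = \<alpha> then r else \<zero>"
  have sub: "{\<beta>. ?c \<beta> \<noteq> \<zero>} \<subseteq> {\<alpha>}" by auto
  have "?c \<in> coeff_families A"
    using assms base_zero finite_subset[OF sub] by (auto simp: coeff_families_def)
  moreover have "lincomb A ?c = r \<otimes> xpow A \<alpha>"
    using assms base_zero sub
    by (subst lincomb_superset[of "{\<alpha>}"]) (auto simp: base_closed xpow_closed)
  ultimately show ?thesis using coeff_of_lincomb by metis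
qed

lemma coeff_of_eqI:
  assumes "f \<in> carrier A" "g \<in> carrier A" "\<And>\<alpha>. coeff_of A f \<alpha> = coeff_of A g \<alpha>"
  shows "f = g"
  using lincomb_coeff_of[OF assms(1)] lincomb_coeff_of[OF assms(2)] assms(3) by (metis ext)

text \<open>Subtraction is addition of (-1) g with -1 in R, so additivity and scaling are
  enough.\<close>

lemma coeff_of_minus:
  assumes "f \<in> carrier A" "g \<in> carrier A"
  shows "coeff_of A (f \<ominus> g) \<alpha> = coeff_of A f \<alpha> \<ominus> coeff_of A g \<alpha>"
proof -
  have "f \<ominus> g = f \<oplus> (\<ominus> \<one>) \<otimes> g" using assms by (simp add: a_minus_def l_minus)
  then have "coeff_of A (f \<ominus> g) \<alpha> = coeff_of A f \<alpha> \<oplus> (\<ominus> \<one>) \<otimes> coeff_of A g \<alpha>"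
    using assms base_minus[OF base_one] by (simp only: coeff_of_add coeff_of_scale base_closed m_closed)
  then show ?thesis
    using assms coeff_of_closed by (simp add: a_minus_def l_minus)
qed

section \<open>Exponents and the leftmost variable of a monomial\<close>

lemma exp_size_add: "exp_size A (exp_add \<alpha> \<beta>) = exp_size A \<alpha> + exp_size A \<beta>"
  by (simp add: exp_size_def exp_add_def sum.distrib)

lemma exp_add_exponents: "\<alpha> \<in> exponents A \<Longrightarrow> \<beta> \<in> exponents A \<Longrightarrow> exp_add \<alpha> \<beta> \<in> exponents A"
  by (simp add: exponents_def exp_add_def)

lemma zero_exponents: "(\<lambda>_. 0) \<in> exponents A"
  by (simp add: exponents_def)

lemma exp_size_eq_0: "\<alpha> \<in> exponents A \<Longrightarrow> exp_size A \<alpha> = 0 \<longleftrightarrow> \<alpha> = (\<lambda>_. 0)"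
  by (auto simp: exponents_def exp_size_def) (metis lessThan_iff not_less ext)

lemma exp_size_upd: "i < nvars A \<Longrightarrow> exp_size A (\<alpha>(i := Suc (\<alpha> i))) = Suc (exp_size A \<alpha>)"
  by (simp add: exp_size_def sum.remove[of _ i])

lemma upd_exponents: "i < nvars A \<Longrightarrow> \<alpha> \<in> exponents A \<Longrightarrow> \<alpha>(i := k) \<in> exponents A"
  by (auto simp: exponents_def)

lemma var_prod_zero: "(\<And>i. i < k \<Longrightarrow> \<alpha> i = 0) \<Longrightarrow> var_prod A \<alpha> k = \<one>"
  by (induction k) auto

lemma xpow_zero: "xpow A (\<lambda>_. 0) = \<one>"
  by (simp add: xpow_def var_prod_zero)

text \<open>All factors in front of position \<open>i\<close> are 1, so the new variable merges with
  its own power and no commutation takes place.\<close>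

lemma var_mult_xpow:
  assumes i: "i < nvars A" and low: "\<And>k. k < i \<Longrightarrow> \<alpha> k = 0"
  shows "var A i \<otimes> xpow A \<alpha> = xpow A (\<alpha>(i := Suc (\<alpha> i)))"
proof -
  let ?\<beta> = "\<alpha>(i := Suc (\<alpha> i))"
  have "i < k \<Longrightarrow> k \<le> nvars A \<Longrightarrow> var A i \<otimes> var_prod A \<alpha> k = var_prod A ?\<beta> k" for k
  proof (induction k)
    case (Suc k)
    show ?case
    proof (cases "k = i")
      case True
      have "var_prod A \<alpha> i = \<one>" "var_prod A ?\<beta> i = \<one>"
        using low by (auto intro!: var_prod_zero)
      then show ?thesis
        using True var_closed[OF i] by (simp add: nat_pow_Suc2[symmetric] del: fun_upd_apply) simp
    next
      case False
      then have "i < k" "k < nvars A" using Suc.prems by auto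
      then show ?thesis
        using Suc.IH False i var_closed var_prod_closed[of k \<alpha>]
        by (simp add: m_assoc[symmetric])
    qed
  qed simp
  with i show ?thesis by (simp add: xpow_def)
qed

text \<open>Strips the leftmost variable of \<open>x^\<alpha>\<close>. It is the one that can be put
  back by left multiplication through \<open>var_mult_xpow\<close>, which is why the induction rule
  below also builds monomials from the left.\<close>

lemma exponent_cases:
  assumes \<alpha>: "\<alpha> \<in> exponents A" and nz: "\<alpha> \<noteq> (\<lambda>_. 0)"
  obtains i \<beta> where "i < nvars A" "\<beta> \<in> exponents A" "\<And>k. k < i \<Longrightarrow> \<beta> k = 0"
    "\<alpha> = \<beta>(i := Suc (\<beta> i))"
proof -
  have ex: "\<exists>i. \<alpha> i \<noteq> 0" using nz by auto
  define i where "i = (LEAST i. \<alpha> i \<noteq> 0)"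
  have i: "\<alpha> i \<noteq> 0" unfolding i_def by (rule LeastI_ex[OF ex])
  have low: "\<And>k. k < i \<Longrightarrow> \<alpha> k = 0" unfolding i_def using not_less_Least by blast
  have iv: "i < nvars A" by (rule ccontr) (use i \<alpha> in \<open>auto simp: exponents_def\<close>)
  show ?thesis
    by (rule that[of i "\<alpha>(i := \<alpha> i - 1)"]) (use iv i low \<alpha> upd_exponents in auto)
qed

lemma exponent_induct [consumes 1, case_names zero step]:
  assumes "\<alpha> \<in> exponents A"
    and "P (\<lambda>_. 0)"
    and "\<And>i \<alpha>. \<lbrakk>i < nvars A; \<alpha> \<in> exponents A; \<And>k. k < i \<Longrightarrow> \<alpha> k = 0; P \<alpha>\<rbrakk>
      \<Longrightarrow> P (\<alpha>(i := Suc (\<alpha> i)))"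
  shows "P \<alpha>"
  using assms(1)
proof (induction "exp_size A \<alpha>" arbitrary: \<alpha> rule: less_induct)
  case less
  show ?case
  proof (cases "\<alpha> = (\<lambda>_. 0)")
    case False
    from exponent_cases[OF less.prems False] obtain i \<beta> where *: "i < nvars A"
      "\<beta> \<in> exponents A" "\<And>k. k < i \<Longrightarrow> \<beta> k = 0" "\<alpha> = \<beta>(i := Suc (\<beta> i))" by blast
    then show ?thesis
      using assms(3)[OF *(1-3)] less.hyps[of \<beta>] exp_size_upd[OF *(1), of \<beta>] by simp
  qed (simp add: assms(2))
qed

section \<open>The filtration in terms of supports\<close>

lemma filt_iff:
  "f \<in> filt A p \<longleftrightarrow> f \<in> carrier A \<and> (\<forall>\<alpha>\<in>supp A f. int (exp_size A \<alpha>) \<le> p)"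
proof -
  have z: "f = \<zero>" if "f \<in> carrier A" "supp A f = {}"
    using coeff_of_eqI[of f \<zero>] that by (auto simp: supp_def coeff_of_zero)
  \<comment> \<open>The three clauses of \<open>filt\<close> are treated in turn. For negative
    \<open>p\<close> the right-hand side forces an empty support, because sizes are natural numbers;
    the empty support of zero also covers the clause \<open>f = \<zero>\<close> in positive
    degrees.\<close>
  consider "p < 0" | "p = 0" | "p > 0" by linarith
  then show ?thesis
  proof cases
    case 1
    then show ?thesis using z by (auto simp: filt_def supp_def coeff_of_zero)
  next
    case 2
    have "f \<in> carrier A \<and> (\<forall>\<alpha>\<in>supp A f. int (exp_size A \<alpha>) \<le> 0)" if "f \<in> base A"
      using coeff_of_monomial[OF that zero_exponents] base_closed[OF that]
      by (auto simp: xpow_zero supp_def exp_size_def split: if_splits)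
    moreover have "f \<in> base A" if "f \<in> carrier A" "\<forall>\<alpha>\<in>supp A f. int (exp_size A \<alpha>) \<le> 0"
    proof -
      \<comment> \<open>The only exponent of size 0 is the zero exponent, so \<open>f\<close> is a
        multiple of \<open>x^0 = 1\<close> and hence its own coefficient.\<close>
      have "supp A f \<subseteq> {\<lambda>_. 0}"
        using that exp_size_eq_0 supp_exponents by fastforce
      then have "f = (\<Oplus>\<alpha>\<in>{\<lambda>_. 0}. coeff_of A f \<alpha> \<otimes> xpow A \<alpha>)"
        using that lincomb_superset[of "{\<lambda>_. 0}" "coeff_of A f"] coeff_of_base
          lincomb_coeff_of[of f] by (auto simp: supp_def)
      then have "f = coeff_of A f (\<lambda>_. 0)"
        using that coeff_of_closed by (simp add: xpow_zero)
      then show ?thesis using coeff_of_base that by metis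
    qed
    ultimately show ?thesis using 2 by (auto simp: filt_def)
  next
    case 3
    have "int (pdeg A f) \<le> p \<longleftrightarrow> (\<forall>\<alpha>\<in>supp A f. int (exp_size A \<alpha>) \<le> p)"
      if "f \<in> carrier A" "f \<noteq> \<zero>"
    proof -
      have "int (pdeg A f) \<le> p \<longleftrightarrow> pdeg A f \<le> nat p" using 3 by linarith
      also have "\<dots> \<longleftrightarrow> (\<forall>\<alpha>\<in>supp A f. exp_size A \<alpha> \<le> nat p)"
        unfolding pdeg_def using finite_supp z that by (subst Max_le_iff) auto
      also have "\<dots> \<longleftrightarrow> (\<forall>\<alpha>\<in>supp A f. int (exp_size A \<alpha>) \<le> p)" using 3 by (auto simp: nat_le_iff le_nat_iff)
      finally show ?thesis .
    qed
    then show ?thesis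
      using 3 by (cases "f = \<zero>") (auto simp: filt_def supp_def coeff_of_zero)
  qed
qed

lemma filt_closed: "f \<in> filt A p \<Longrightarrow> f \<in> carrier A"
  by (simp add: filt_iff)

lemma filt_add: "f \<in> filt A p \<Longrightarrow> g \<in> filt A p \<Longrightarrow> f \<oplus> g \<in> filt A p"
  by (auto simp: filt_iff supp_def coeff_of_add)
    (metis add.l_cancel_one' coeff_of_closed l_zero)

lemma filt_zero: "\<zero> \<in> filt A p"
  by (simp add: filt_iff supp_def coeff_of_zero)

lemma filt_scale: "r \<in> base A \<Longrightarrow> f \<in> filt A p \<Longrightarrow> r \<otimes> f \<in> filt A p"
  by (auto simp: filt_iff supp_def coeff_of_scale base_closed) (metis base_closed r_null)

lemma filt_mono: "f \<in> filt A p \<Longrightarrow> p \<le> q \<Longrightarrow> f \<in> filt A q"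
  by (fastforce simp: filt_iff)

lemma filt_minus: "f \<in> filt A p \<Longrightarrow> \<ominus> f \<in> filt A p"
  using filt_scale[OF base_minus[OF base_one], of f p] by (simp add: l_minus filt_closed)

lemma filt_monomial:
  "r \<in> base A \<Longrightarrow> \<alpha> \<in> exponents A \<Longrightarrow> int (exp_size A \<alpha>) \<le> p \<Longrightarrow> r \<otimes> xpow A \<alpha> \<in> filt A p"
  by (auto simp: filt_iff base_closed xpow_closed supp_def coeff_of_monomial split: if_splits)

lemma filt_xpow: "\<alpha> \<in> exponents A \<Longrightarrow> int (exp_size A \<alpha>) \<le> p \<Longrightarrow> xpow A \<alpha> \<in> filt A p"
  using filt_monomial[OF base_one] xpow_closed by simp

lemma filt_finsum:
  "(\<And>i. i \<in> S \<Longrightarrow> f i \<in> filt A p) \<Longrightarrow> (\<Oplus>i\<in>S. f i) \<in> filt A p"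
proof (induction S rule: infinite_finite_induct)
  case (insert i S)
  then show ?case
    by (subst finsum_insert) (auto intro!: filt_add intro: filt_closed)
qed (auto simp: filt_zero)

text \<open>An element of F_p is the sum of its terms, each of which has degree at most
  \<open>p\<close>; the finite induction runs over subsets of the support.\<close>

lemma filt_induct [consumes 1, case_names zero add monomial]:
  assumes f: "f \<in> filt A p"
    and zero: "P \<zero>"
    and add: "\<And>f g. \<lbrakk>f \<in> carrier A; g \<in> carrier A; P f; P g\<rbrakk> \<Longrightarrow> P (f \<oplus> g)"
    and mono: "\<And>r \<alpha>. \<lbrakk>r \<in> base A; \<alpha> \<in> exponents A; int (exp_size A \<alpha>) \<le> p\<rbrakk> \<Longrightarrow> P (r \<otimes> xpow A \<alpha>)"
  shows "P f"
proof -
  let ?m = "\<lambda>\<alpha>. coeff_of A f \<alpha> \<otimes> xpow A \<alpha>"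
  have c: "f \<in> carrier A" by (rule filt_closed[OF f])
  have "S \<subseteq> supp A f \<Longrightarrow> P (\<Oplus>\<alpha>\<in>S. ?m \<alpha>)" if "finite S" for S
    using that
  proof (induction S)
    case (insert \<alpha> S)
    have "P (?m \<alpha>)"
      using insert.prems f c supp_exponents by (intro mono coeff_of_base) (auto simp: filt_iff)
    moreover have "?m ` (insert \<alpha> S) \<subseteq> carrier A"
      using c coeff_of_closed xpow_closed by auto
    ultimately show ?case
      using insert by (subst finsum_insert) (auto intro!: add finsum_closed)
  qed (simp add: zero)
  from this[OF finite_supp[OF c]] have "P (lincomb A (coeff_of A f))"
    by (simp add: lincomb_def supp_def)
  then show ?thesis by (simp only: lincomb_coeff_of[OF c])
qed

section \<open>Commutation rules and products\<close>

lemma add_diff_eq: "x \<in> carrier A \<Longrightarrow> y \<in> carrier A \<Longrightarrow> x = y \<oplus> (x \<ominus> y)"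
  by (simp add: a_minus_def a_lcomm[of y x] r_neg)

text \<open>Turns the axiom on differences into a rewrite rule for every \<open>r\<close>. The axiom
  covers nonzero \<open>r\<close>; for \<open>r = \<zero>\<close> both coefficients are taken to be
  zero.\<close>

lemma var_mult_base:
  assumes "i < nvars A" "r \<in> base A"
  obtains c d where "c \<in> base A" "d \<in> base A" "var A i \<otimes> r = c \<otimes> var A i \<oplus> d"
proof (cases "r = \<zero>")
  case True
  then show ?thesis using that[of \<zero> \<zero>] base_zero assms var_closed by simp
next
  case False
  then obtain c where c: "c \<in> base A" "var A i \<otimes> r \<ominus> c \<otimes> var A i \<in> base A"
    using var_base assms by blast
  have "var A i \<otimes> r = c \<otimes> var A i \<oplus> (var A i \<otimes> r \<ominus> c \<otimes> var A i)"
    using assms c(1) base_closed var_closed by (intro add_diff_eq) auto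
  then show ?thesis using that c by blast
qed

lemma var_mult_var:
  assumes "i < nvars A" "j < nvars A"
  obtains c r s where "c \<in> base A" "r \<in> base A" "\<And>k. k < nvars A \<Longrightarrow> s k \<in> base A"
    "var A j \<otimes> var A i = c \<otimes> (var A i \<otimes> var A j) \<oplus> (r \<oplus> (\<Oplus>k\<in>{..<nvars A}. s k \<otimes> var A k))"
proof -
  obtain c r s where *: "c \<in> base A" "r \<in> base A" "s \<in> {..<nvars A} \<rightarrow> base A"
    "var A j \<otimes> var A i \<ominus> c \<otimes> (var A i \<otimes> var A j) = r \<oplus> (\<Oplus>k\<in>{..<nvars A}. s k \<otimes> var A k)"
    using var_var[OF assms] by blast
  have "var A j \<otimes> var A i = c \<otimes> (var A i \<otimes> var A j) \<oplus>
     (var A j \<otimes> var A i \<ominus> c \<otimes> (var A i \<otimes> var A j))"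
    using assms *(1) base_closed var_closed by (intro add_diff_eq) auto
  then show ?thesis using that[of c r s] * by auto
qed

text \<open>The claim on monomials is an assumption here because this lemma is used inside the
  induction that proves it, where the claim is available only for sizes up to a smaller bound
  \<open>p\<close>.\<close>

lemma var_mult_filt_of_xpow:
  assumes i: "i < nvars A" and f: "f \<in> filt A p"
    and mono: "\<And>\<alpha>. \<alpha> \<in> exponents A \<Longrightarrow> int (exp_size A \<alpha>) \<le> p \<Longrightarrow>
      \<exists>c\<in>base A. \<exists>h\<in>filt A (int (exp_size A \<alpha>)).
        var A i \<otimes> xpow A \<alpha> = c \<otimes> xpow A (\<alpha>(i := Suc (\<alpha> i))) \<oplus> h"
  shows "var A i \<otimes> f \<in> filt A (p + 1)"
  using f
proof (induction rule: filt_induct)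
  case zero
  show ?case using i var_closed filt_zero by simp
next
  case (add f g)
  then show ?case using i var_closed filt_add by (simp add: r_distr)
next
  case (monomial r \<alpha>)
  obtain c d where cd: "c \<in> base A" "d \<in> base A" "var A i \<otimes> r = c \<otimes> var A i \<oplus> d"
    using var_mult_base[OF i monomial(1)] .
  obtain e h where eh: "e \<in> base A" "h \<in> filt A (int (exp_size A \<alpha>))"
      "var A i \<otimes> xpow A \<alpha> = e \<otimes> xpow A (\<alpha>(i := Suc (\<alpha> i))) \<oplus> h"
    using mono[OF monomial(2,3)] by blast
  have "var A i \<otimes> xpow A \<alpha> \<in> filt A (p + 1)"
    unfolding eh(3) using eh monomial exp_size_upd[OF i, of \<alpha>]
    by (intro filt_add filt_monomial upd_exponents i) (auto elim!: filt_mono)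
  \<comment> \<open>Moving the variable past \<open>r\<close> leaves two terms: one of degree at
    most \<open>p + 1\<close>, and \<open>d x^\<alpha>\<close>, in which the variable has
    disappeared.\<close>
  moreover have "var A i \<otimes> (r \<otimes> xpow A \<alpha>) = c \<otimes> (var A i \<otimes> xpow A \<alpha>) \<oplus> d \<otimes> xpow A \<alpha>"
    using cd monomial base_closed var_closed[OF i] xpow_closed
    by (simp add: m_assoc[symmetric] l_distr)
  ultimately show ?case
    using cd(1,2) monomial by (auto intro!: filt_add filt_scale filt_xpow)
qed

text \<open>If the first variable \<open>x\<^sub>k\<close> of \<open>x\<^sup>\<alpha>\<close> has \<open>k < i\<close>, commute \<open>x\<^sub>i\<close> past it; \<open>x\<^sub>i\<close> then meets a shorter
  monomial, and the \<open>x\<^sub>k\<close> put back in front is in standard position again.\<close>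
lemma var_mult_xpow_filt:
  assumes "i < nvars A" "\<alpha> \<in> exponents A"
  shows "\<exists>c\<in>base A. \<exists>h\<in>filt A (int (exp_size A \<alpha>)).
        var A i \<otimes> xpow A \<alpha> = c \<otimes> xpow A (\<alpha>(i := Suc (\<alpha> i))) \<oplus> h"
  using assms
proof (induction "exp_size A \<alpha>" arbitrary: i \<alpha> rule: less_induct)
  case less
  note i = less.prems(1)
  have IH: "\<exists>c\<in>base A. \<exists>h\<in>filt A (int (exp_size A \<beta>)).
        var A j \<otimes> xpow A \<beta> = c \<otimes> xpow A (\<beta>(j := Suc (\<beta> j))) \<oplus> h"
    if "exp_size A \<beta> < exp_size A \<alpha>" "j < nvars A" "\<beta> \<in> exponents A" for \<beta> j
    using less.hyps that by blast
  \<comment> \<open>The induction hypothesis extended from monomials to all elements of degree below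
    that of \<open>x^\<alpha>\<close>. It is what handles the remainders.\<close>
  have IH2: "var A j \<otimes> f \<in> filt A (p + 1)"
    if "f \<in> filt A p" "p < int (exp_size A \<alpha>)" "j < nvars A" for f j p
    using var_mult_filt_of_xpow[OF that(3,1)] IH that by force
  show ?case
  proof (cases "\<forall>k<i. \<alpha> k = 0")
    case True
    then show ?thesis
      using var_mult_xpow[OF i, of \<alpha>] base_one filt_zero xpow_closed
      by (intro bexI[of _ \<one>] bexI[of _ \<zero>]) auto
  next
    case False
    then have "\<alpha> \<noteq> (\<lambda>_. 0)" by auto
    then obtain k \<beta> where step: "k < nvars A" "\<beta> \<in> exponents A" "\<And>l. l < k \<Longrightarrow> \<beta> l = 0"
      and \<alpha>: "\<alpha> = \<beta>(k := Suc (\<beta> k))"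
      using exponent_cases[OF less.prems(2)] by blast
    \<comment> \<open>\<open>x_k\<close> is the leftmost variable of \<open>x^\<alpha>\<close>, so
      \<open>i \<le> k\<close> would leave nothing in front of position \<open>i\<close>, which is
      the case already settled.\<close>
    have "k < i"
    proof (rule ccontr)
      assume "\<not> k < i"
      then show False using False step(3) \<alpha> by auto
    qed
    have sz: "exp_size A \<alpha> = Suc (exp_size A \<beta>)" using exp_size_upd[OF step(1), of \<beta>] \<alpha> by simp
    let ?X = "xpow A \<beta>" and ?Y = "xpow A (\<beta>(i := Suc (\<beta> i)))"
    have xk: "xpow A \<alpha> = var A k \<otimes> ?X" using var_mult_xpow[OF step(1), of \<beta>] step(3) \<alpha> by auto
    obtain c r s where crs: "c \<in> base A" "r \<in> base A" "\<And>k. k < nvars A \<Longrightarrow> s k \<in> base A"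
      and vv: "var A i \<otimes> var A k = c \<otimes> (var A k \<otimes> var A i) \<oplus> (r \<oplus> (\<Oplus>k\<in>{..<nvars A}. s k \<otimes> var A k))"
      using var_mult_var[OF step(1) i] by blast
    obtain d h where dh: "d \<in> base A" "h \<in> filt A (int (exp_size A \<beta>))"
        "var A i \<otimes> ?X = d \<otimes> ?Y \<oplus> h"
      using IH[OF _ i step(2)] sz by auto
    \<comment> \<open>The coefficient \<open>d\<close> produced by the shorter monomial now stands
      to the right of \<open>x_k\<close> and has to be moved to the left once more.\<close>
    obtain e t where et: "e \<in> base A" "t \<in> base A" "var A k \<otimes> d = e \<otimes> var A k \<oplus> t"
      using var_mult_base[OF step(1) dh(1)] .
    \<comment> \<open>Since \<open>k < i\<close>, raising the exponent at \<open>i\<close> keeps all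
      positions before \<open>k\<close> empty, so \<open>x_k\<close> can be put in front without
      commutation.\<close>
    have Y: "var A k \<otimes> ?Y = xpow A (\<alpha>(i := Suc (\<alpha> i)))"
    proof -
      have "var A k \<otimes> ?Y = xpow A ((\<beta>(i := Suc (\<beta> i)))(k := Suc ((\<beta>(i := Suc (\<beta> i))) k)))"
        using step(3) \<open>k < i\<close> by (intro var_mult_xpow step(1)) auto
      also have "(\<beta>(i := Suc (\<beta> i)))(k := Suc ((\<beta>(i := Suc (\<beta> i))) k)) = \<alpha>(i := Suc (\<alpha> i))"
        using \<open>k < i\<close> \<alpha> by auto
      finally show ?thesis .
    qed
    note cl = base_closed[OF crs(1)] base_closed[OF crs(2)] base_closed[OF crs(3)]
      base_closed[OF dh(1)] base_closed[OF et(1)] base_closed[OF et(2)] xpow_closed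
      var_closed[OF i] var_closed[OF step(1)] filt_closed[OF dh(2)] var_closed
    let ?s = "\<Oplus>k\<in>{..<nvars A}. s k \<otimes> var A k"
    have scl: "?s \<in> carrier A" using cl by (auto intro!: finsum_closed)
    have "var A i \<otimes> xpow A \<alpha> = (var A i \<otimes> var A k) \<otimes> ?X"
      unfolding xk using cl by (simp add: m_assoc)
    also have "\<dots> = c \<otimes> (var A k \<otimes> (var A i \<otimes> ?X)) \<oplus> (r \<otimes> ?X \<oplus> ?s \<otimes> ?X)"
      unfolding vv using cl scl by (simp add: m_assoc l_distr)
    also have "var A k \<otimes> (var A i \<otimes> ?X) = (var A k \<otimes> d) \<otimes> ?Y \<oplus> var A k \<otimes> h"
      unfolding dh(3) using cl by (simp add: r_distr m_assoc)
    also have "(var A k \<otimes> d) \<otimes> ?Y = e \<otimes> xpow A (\<alpha>(i := Suc (\<alpha> i))) \<oplus> t \<otimes> ?Y"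
      unfolding et(3) Y[symmetric] using cl by (simp add: l_distr m_assoc)
    also have "?s \<otimes> ?X = (\<Oplus>k\<in>{..<nvars A}. s k \<otimes> (var A k \<otimes> ?X))"
      using cl by (subst finsum_ldistr) (auto simp: m_assoc intro!: finsum_cong')
    also have "c \<otimes> (e \<otimes> xpow A (\<alpha>(i := Suc (\<alpha> i))) \<oplus> t \<otimes> ?Y \<oplus> var A k \<otimes> h) \<oplus>
        (r \<otimes> ?X \<oplus> (\<Oplus>k\<in>{..<nvars A}. s k \<otimes> (var A k \<otimes> ?X))) =
      (c \<otimes> e) \<otimes> xpow A (\<alpha>(i := Suc (\<alpha> i))) \<oplus>
      (c \<otimes> (t \<otimes> ?Y) \<oplus> c \<otimes> (var A k \<otimes> h) \<oplus>
        (r \<otimes> ?X \<oplus> (\<Oplus>k\<in>{..<nvars A}. s k \<otimes> (var A k \<otimes> ?X))))" (is "_ = _ \<oplus> ?H")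
      using cl by (simp add: r_distr m_assoc a_assoc finsum_closed)
    finally have main: "var A i \<otimes> xpow A \<alpha> = (c \<otimes> e) \<otimes> xpow A (\<alpha>(i := Suc (\<alpha> i))) \<oplus> ?H" .
    have X: "?X \<in> filt A (int (exp_size A \<beta>))" using filt_xpow step(2) by simp
    have vX: "var A l \<otimes> ?X \<in> filt A (int (exp_size A \<alpha>))" if "l < nvars A" for l
      using IH2[OF X _ that] sz by (simp add: add.commute)
    \<comment> \<open>With the size of \<open>\<alpha>\<close> one more than that of
      \<open>\<beta>\<close>: \<open>?Y\<close> has degree equal to the size of
      \<open>\<alpha>\<close>, \<open>?X\<close> one less, and by \<open>IH2\<close> multiplying
      \<open>h\<close> or \<open>?X\<close> by a variable reaches at most the size of
      \<open>\<alpha>\<close>. This is one below the degree of the leading term.\<close>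
    have "?H \<in> filt A (int (exp_size A \<alpha>))"
      using vX crs et filt_mono[OF X] IH2[OF dh(2) _ step(1)] sz
        filt_xpow[OF upd_exponents[OF i step(2)], of "Suc (\<beta> i)"] exp_size_upd[OF i, of \<beta>]
      by (intro filt_add filt_finsum filt_scale[OF crs(1)] filt_scale[OF et(2)]
        filt_scale[OF crs(2)] filt_scale[OF crs(3)]) (auto simp: add.commute)
    with main show ?thesis using base_mult[OF crs(1) et(1)] by blast
  qed
qed

lemma var_mult_filt:
  assumes "i < nvars A" "f \<in> filt A p"
  shows "var A i \<otimes> f \<in> filt A (p + 1)"
  using var_mult_filt_of_xpow[OF assms] var_mult_xpow_filt[OF assms(1)] by blast

text \<open>\<open>x^\<alpha>\<close> is built up from the left, one variable at a time: each
  variable turns the leading term into the next one with a new coefficient and raises the remainder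
  by one degree. The coefficient \<open>r\<close> in the middle makes this one source for both kinds
  of structure constants: \<open>\<beta> = 0\<close> yields \<open>sigma\<close>, and
  \<open>r = \<one>\<close> yields \<open>cmul\<close>.\<close>

lemma xpow_mult_monomial:
  assumes "\<alpha> \<in> exponents A" "\<beta> \<in> exponents A" "r \<in> base A"
  shows "\<exists>s\<in>base A. \<exists>h\<in>filt A (int (exp_size A (exp_add \<alpha> \<beta>)) - 1).
    xpow A \<alpha> \<otimes> (r \<otimes> xpow A \<beta>) = s \<otimes> xpow A (exp_add \<alpha> \<beta>) \<oplus> h"
  using assms(1)
proof (induction rule: exponent_induct)
  case zero
  show ?case
    using assms xpow_closed base_closed filt_zero
    by (intro bexI[of _ r] bexI[of _ \<zero>]) (auto simp: xpow_zero exp_add_def)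
next
  case (step i \<alpha>)
  define \<gamma> where "\<gamma> = exp_add \<alpha> \<beta>"
  have \<gamma>: "\<gamma> \<in> exponents A" unfolding \<gamma>_def using exp_add_exponents step(2) assms(2) by blast
  have \<gamma>i: "exp_add (\<alpha>(i := Suc (\<alpha> i))) \<beta> = \<gamma>(i := Suc (\<gamma> i))"
    by (auto simp: \<gamma>_def exp_add_def)
  \<comment> \<open>The new remainder may have degree up to the size of \<open>\<gamma>\<close>,
    since the leading exponent has grown by one.\<close>
  have sz: "int (exp_size A (\<gamma>(i := Suc (\<gamma> i)))) - 1 = int (exp_size A \<gamma>)"
    using exp_size_upd[OF step(1), of \<gamma>] by simp
  obtain s h where sh: "s \<in> base A" "h \<in> filt A (int (exp_size A \<gamma>) - 1)"
      "xpow A \<alpha> \<otimes> (r \<otimes> xpow A \<beta>) = s \<otimes> xpow A \<gamma> \<oplus> h"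
    using step(4) \<gamma>_def by blast
  obtain c d where cd: "c \<in> base A" "d \<in> base A" "var A i \<otimes> s = c \<otimes> var A i \<oplus> d"
    using var_mult_base[OF step(1) sh(1)] .
  obtain c' h' where ch': "c' \<in> base A" "h' \<in> filt A (int (exp_size A \<gamma>))"
      "var A i \<otimes> xpow A \<gamma> = c' \<otimes> xpow A (\<gamma>(i := Suc (\<gamma> i))) \<oplus> h'"
    using var_mult_xpow_filt[OF step(1) \<gamma>] by blast
  note cl = base_closed[OF sh(1)] filt_closed[OF sh(2)] base_closed[OF cd(1)] base_closed[OF cd(2)]
    base_closed[OF ch'(1)] filt_closed[OF ch'(2)] xpow_closed var_closed[OF step(1)] base_closed[OF assms(3)]
  have "xpow A (\<alpha>(i := Suc (\<alpha> i))) \<otimes> (r \<otimes> xpow A \<beta>) = var A i \<otimes> (xpow A \<alpha> \<otimes> (r \<otimes> xpow A \<beta>))"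
    using var_mult_xpow[OF step(1), of \<alpha>] step(3) cl by (simp add: m_assoc[symmetric])
  also have "\<dots> = (var A i \<otimes> s) \<otimes> xpow A \<gamma> \<oplus> var A i \<otimes> h"
    unfolding sh(3) using cl by (simp add: r_distr m_assoc)
  also have "(var A i \<otimes> s) \<otimes> xpow A \<gamma> = c \<otimes> (var A i \<otimes> xpow A \<gamma>) \<oplus> d \<otimes> xpow A \<gamma>"
    unfolding cd(3) using cl by (simp add: l_distr m_assoc)
  also have "c \<otimes> (var A i \<otimes> xpow A \<gamma>) \<oplus> d \<otimes> xpow A \<gamma> \<oplus> var A i \<otimes> h =
    (c \<otimes> c') \<otimes> xpow A (\<gamma>(i := Suc (\<gamma> i))) \<oplus> (c \<otimes> h' \<oplus> d \<otimes> xpow A \<gamma> \<oplus> var A i \<otimes> h)"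
    unfolding ch'(3) using cl by (simp add: r_distr m_assoc a_assoc)
  finally have "xpow A (\<alpha>(i := Suc (\<alpha> i))) \<otimes> (r \<otimes> xpow A \<beta>) =
    (c \<otimes> c') \<otimes> xpow A (\<gamma>(i := Suc (\<gamma> i))) \<oplus> (c \<otimes> h' \<oplus> d \<otimes> xpow A \<gamma> \<oplus> var A i \<otimes> h)" .
  moreover have "c \<otimes> h' \<oplus> d \<otimes> xpow A \<gamma> \<oplus> var A i \<otimes> h \<in> filt A (int (exp_size A \<gamma>))"
    using cd ch' var_mult_filt[OF step(1) sh(2)] filt_xpow[OF \<gamma>] 
    by (intro filt_add filt_scale[OF cd(1) ch'(2)] filt_scale[OF cd(2)]) auto
  ultimately show ?case
    unfolding \<gamma>i sz using base_mult[OF cd(1) ch'(1)] by blast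
qed

text \<open>By distributivity in each factor only products of two terms remain, and for these sizes
  of exponents add.\<close>

lemma filt_mult:
  assumes f: "f \<in> filt A p" and g: "g \<in> filt A q"
  shows "f \<otimes> g \<in> filt A (p + q)"
  using f
proof (induction rule: filt_induct)
  case zero
  show ?case using filt_zero filt_closed[OF g] by simp
next
  case (add f f')
  then show ?case using filt_add filt_closed[OF g] by (simp add: l_distr)
next
  case (monomial r \<alpha>)
  have "xpow A \<alpha> \<otimes> g \<in> filt A (p + q)"
    using g
  proof (induction rule: filt_induct)
    case zero
    show ?case using filt_zero xpow_closed by simp
  next
    case (add f f')
    then show ?case using filt_add xpow_closed by (simp add: r_distr)
  next
    case (monomial r' \<beta>)
    obtain s h where "s \<in> base A" "h \<in> filt A (int (exp_size A (exp_add \<alpha> \<beta>)) - 1)"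
      "xpow A \<alpha> \<otimes> (r' \<otimes> xpow A \<beta>) = s \<otimes> xpow A (exp_add \<alpha> \<beta>) \<oplus> h"
      using xpow_mult_monomial[OF \<open>\<alpha> \<in> exponents A\<close> monomial(2,1)] by blast
    then show ?case
      using monomial \<open>\<alpha> \<in> exponents A\<close> \<open>int (exp_size A \<alpha>) \<le> p\<close>
      by (auto intro!: filt_add filt_monomial exp_add_exponents elim!: filt_mono simp: exp_size_add)
  qed
  then show ?case
    using monomial filt_scale[OF monomial(1)] base_closed xpow_closed filt_closed[OF g]
    by (simp add: m_assoc)
qed

end


section \<open>The basis of the associated graded ring\<close>

text \<open>The degree is a parameter and need not be that of \<open>f\<close>; the class is zero
  when \<open>f\<close> lies in F_{p-1}. Unlike \<open>symbol\<close>, this is additive in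
  \<open>f\<close>, and it stays compatible with products when leading coefficients multiply to
  zero.\<close>

definition gr_elem :: "('a, 'm) pbw_scheme \<Rightarrow> nat \<Rightarrow> 'a \<Rightarrow> nat \<Rightarrow> 'a set" where
  "gr_elem A p f = in_degree A p (filt A (int p - 1) +>\<^bsub>A\<^esub> f)"

lemma gr_comp_mult: "X \<otimes>\<^bsub>gr_comp A p\<^esub> Y = X <+>\<^bsub>A\<^esub> Y"
  by (simp add: gr_comp_def A_FactGroup_def FactGroup_def set_add_def set_mult_def)

lemma gr_comp_one: "\<one>\<^bsub>gr_comp A p\<^esub> = filt A (int p - 1)"
  by (simp add: gr_comp_def A_FactGroup_def FactGroup_def)

lemma gr_comp_carrier:
  "carrier (gr_comp A p) = (\<lambda>f. filt A (int p - 1) +>\<^bsub>A\<^esub> f) ` filt A (int p)"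
  by (auto simp: gr_comp_def A_FactGroup_def FactGroup_def RCOSETS_def a_r_coset_def r_coset_def)

lemma gr_carrier:
  "u \<in> carrier (gr A) \<longleftrightarrow>
     (\<forall>p. u p \<in> carrier (gr_comp A p)) \<and> finite {p. u p \<noteq> filt A (int p - 1)}"
  by (simp add: gr_def gr_comp_one)

lemma gr_add: "(u \<oplus>\<^bsub>gr A\<^esub> v) p = u p <+>\<^bsub>A\<^esub> v p"
  by (simp add: gr_def gr_comp_mult)

lemma gr_zero: "\<zero>\<^bsub>gr A\<^esub> p = filt A (int p - 1)"
  by (simp add: gr_def gr_comp_one)

lemma gr_one: "\<one>\<^bsub>gr A\<^esub> = gr_elem A 0 \<one>\<^bsub>A\<^esub>"
  by (simp add: gr_def gr_elem_def)

lemma gr_nvars [simp]: "nvars (gr A) = nvars A"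
  by (simp add: gr_def)

lemma gr_exponents [simp]: "exponents (gr A) = exponents A"
  by (simp add: exponents_def)

lemma gr_exp_size [simp]: "exp_size (gr A) = exp_size A"
  by (simp add: exp_size_def fun_eq_iff)

lemma symbol_eq_gr_elem: "symbol A f = gr_elem A (pdeg A f) f"
  by (simp add: symbol_def gr_elem_def)

context skew_PBW
begin

section \<open>Cosets, and sums and products in Gr(A)\<close>

lemma filt_subgroup: "abelian_subgroup (filt A p) A"
proof (rule abelian_subgroupI3)
  show "additive_subgroup (filt A p) A"
    by (intro additive_subgroupI add.subgroupI)
      (auto simp: filt_closed filt_add filt_minus intro: filt_zero)
qed unfold_locales

lemma filt_0: "filt A 0 = base A"
  by (simp add: filt_def)

lemma filt_m1: "filt A (- 1) = {\<zero>}"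
  by (simp add: filt_def)

lemma coset_eq_iff:
  assumes "f \<in> carrier A" "g \<in> carrier A"
  shows "filt A p +> f = filt A p +> g \<longleftrightarrow> f \<ominus> g \<in> filt A p"
proof
  assume "filt A p +> f = filt A p +> g"
  then have "f \<in> filt A p +> g"
    using abelian_subgroup.a_rcos_self[OF filt_subgroup assms(1)] by blast
  then obtain h where "h \<in> filt A p" "f = h \<oplus> g" by (auto simp: a_r_coset_def')
  then show "f \<ominus> g \<in> filt A p"
    using assms filt_closed by (simp add: a_minus_def a_assoc r_neg)
next
  assume *: "f \<ominus> g \<in> filt A p"
  have "f = (f \<ominus> g) \<oplus> g" using assms by (simp add: a_minus_def a_assoc l_neg)
  with * have "f \<in> filt A p +> g" by (auto simp: a_r_coset_def')
  then show "filt A p +> f = filt A p +> g"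
    using abelian_subgroup.a_repr_independence'[OF filt_subgroup _ assms(2)] by metis
qed

lemma coset_zero [simp]: "filt A p +> \<zero> = filt A p"
  using filt_closed by (intro a_coset_add_zero) auto

lemma coset_eq_filt_iff: "f \<in> carrier A \<Longrightarrow> filt A p +> f = filt A p \<longleftrightarrow> f \<in> filt A p"
  using coset_eq_iff[of f \<zero> p] by (simp add: a_minus_def)

lemma coset_add:
  "f \<in> carrier A \<Longrightarrow> g \<in> carrier A \<Longrightarrow> (filt A p +> f) <+> (filt A p +> g) = filt A p +> (f \<oplus> g)"
  by (rule abelian_subgroup.a_rcos_sum[OF filt_subgroup])

lemma gr_compE:
  assumes "X \<in> carrier (gr_comp A p)"
  obtains f where "f \<in> filt A (int p)" "f \<in> carrier A" "X = filt A (int p - 1) +> f"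
  using assms filt_closed by (auto simp: gr_comp_carrier)

lemma gr_compI: "f \<in> filt A (int p) \<Longrightarrow> filt A (int p - 1) +> f \<in> carrier (gr_comp A p)"
  by (simp add: gr_comp_carrier)

lemma gr_comp_monoid: "comm_monoid (gr_comp A p)"
proof (rule comm_monoidI)
  show "\<one>\<^bsub>gr_comp A p\<^esub> \<in> carrier (gr_comp A p)"
    unfolding gr_comp_one gr_comp_carrier using filt_zero coset_zero by (metis imageI)
next
  fix X Y assume "X \<in> carrier (gr_comp A p)" "Y \<in> carrier (gr_comp A p)"
  then show "X \<otimes>\<^bsub>gr_comp A p\<^esub> Y \<in> carrier (gr_comp A p)"
    "X \<otimes>\<^bsub>gr_comp A p\<^esub> Y = Y \<otimes>\<^bsub>gr_comp A p\<^esub> X"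
    by (auto elim!: gr_compE simp: gr_comp_mult coset_add a_comm intro!: gr_compI filt_add)
next
  fix X Y Z
  assume "X \<in> carrier (gr_comp A p)" "Y \<in> carrier (gr_comp A p)" "Z \<in> carrier (gr_comp A p)"
  then show "X \<otimes>\<^bsub>gr_comp A p\<^esub> Y \<otimes>\<^bsub>gr_comp A p\<^esub> Z = X \<otimes>\<^bsub>gr_comp A p\<^esub> (Y \<otimes>\<^bsub>gr_comp A p\<^esub> Z)"
    by (auto elim!: gr_compE simp: gr_comp_mult coset_add a_assoc)
next
  fix X assume "X \<in> carrier (gr_comp A p)"
  then show "\<one>\<^bsub>gr_comp A p\<^esub> \<otimes>\<^bsub>gr_comp A p\<^esub> X = X"
    using coset_add[OF zero_closed, of _ "int p - 1"]
    by (auto elim!: gr_compE simp: gr_comp_mult gr_comp_one)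
qed

text \<open>Gives the laws of finite sums in \<open>gr A\<close>, on which
  \<open>lincomb (gr A)\<close> rests.\<close>

lemma gr_abelian_monoid: "abelian_monoid (gr A)"
proof (rule abelian_monoidI)
  note M = gr_comp_monoid
  note cl = monoid.m_closed[OF comm_monoid.axioms(1)[OF M]]
    and one = monoid.l_one[OF comm_monoid.axioms(1)[OF M]]
    and one_cl = monoid.one_closed[OF comm_monoid.axioms(1)[OF M]]
    and assoc = monoid.m_assoc[OF comm_monoid.axioms(1)[OF M]]
    and comm = comm_monoid.m_comm[OF M]
  show "\<zero>\<^bsub>gr A\<^esub> \<in> carrier (gr A)"
    using one_cl by (auto simp: gr_carrier gr_zero gr_comp_one)
  fix u v assume u: "u \<in> carrier (gr A)" and v: "v \<in> carrier (gr A)"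
  have fin: "finite ({p. u p \<noteq> filt A (int p - 1)} \<union> {p. v p \<noteq> filt A (int p - 1)})"
    using u v by (simp add: gr_carrier)
  have "{p. (u \<oplus>\<^bsub>gr A\<^esub> v) p \<noteq> filt A (int p - 1)} \<subseteq>
     {p. u p \<noteq> filt A (int p - 1)} \<union> {p. v p \<noteq> filt A (int p - 1)}"
    using one[OF one_cl] by (auto simp: gr_add gr_comp_mult gr_comp_one)
  from finite_subset[OF this fin] show "u \<oplus>\<^bsub>gr A\<^esub> v \<in> carrier (gr A)"
    using cl u v by (simp add: gr_carrier gr_add gr_comp_mult)
  show "u \<oplus>\<^bsub>gr A\<^esub> v = v \<oplus>\<^bsub>gr A\<^esub> u"
  proof
    fix p
    show "(u \<oplus>\<^bsub>gr A\<^esub> v) p = (v \<oplus>\<^bsub>gr A\<^esub> u) p"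
      using comm[of "u p" p "v p"] u v by (simp add: gr_carrier gr_add gr_comp_mult)
  qed
  show "\<zero>\<^bsub>gr A\<^esub> \<oplus>\<^bsub>gr A\<^esub> u = u"
    using one u by (auto simp: gr_carrier gr_add gr_comp_mult gr_zero gr_comp_one)
  fix w assume w: "w \<in> carrier (gr A)"
  show "u \<oplus>\<^bsub>gr A\<^esub> v \<oplus>\<^bsub>gr A\<^esub> w = u \<oplus>\<^bsub>gr A\<^esub> (v \<oplus>\<^bsub>gr A\<^esub> w)"
  proof
    fix p
    show "(u \<oplus>\<^bsub>gr A\<^esub> v \<oplus>\<^bsub>gr A\<^esub> w) p = (u \<oplus>\<^bsub>gr A\<^esub> (v \<oplus>\<^bsub>gr A\<^esub> w)) p"
      using assoc[of "u p" p "v p" "w p"] u v w by (simp add: gr_carrier gr_add gr_comp_mult)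
  qed
qed

text \<open>The case distinction sits inside the coset, so all components have the same shape and
  the coset rules apply to every degree uniformly.\<close>

lemma gr_elem_apply:
  "gr_elem A p f q = filt A (int q - 1) +> (if q = p then f else \<zero>)"
  by (simp add: gr_elem_def in_degree_def gr_comp_one)

lemma gr_elem_carrier:
  assumes "f \<in> filt A (int p)" shows "gr_elem A p f \<in> carrier (gr A)"
proof -
  have "{q. gr_elem A p f q \<noteq> filt A (int q - 1)} \<subseteq> {p}"
    by (auto simp: gr_elem_apply)
  from finite_subset[OF this] show ?thesis
    using assms filt_zero
    by (auto simp: gr_carrier gr_comp_carrier gr_elem_apply simp del: coset_zero)
qed

lemma gr_elem_eq_iff:
  assumes "f \<in> carrier A" "g \<in> carrier A"
  shows "gr_elem A p f = gr_elem A p g \<longleftrightarrow> f \<ominus> g \<in> filt A (int p - 1)"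
  using assms by (auto simp: fun_eq_iff gr_elem_apply coset_eq_iff a_minus_def filt_zero)

lemma gr_elem_eq_zero_iff:
  assumes "f \<in> carrier A"
  shows "gr_elem A p f = \<zero>\<^bsub>gr A\<^esub> \<longleftrightarrow> f \<in> filt A (int p - 1)"
  using assms by (auto simp: fun_eq_iff gr_elem_apply gr_zero coset_eq_filt_iff filt_zero)

lemma gr_elem_add:
  assumes "f \<in> carrier A" "g \<in> carrier A"
  shows "gr_elem A p f \<oplus>\<^bsub>gr A\<^esub> gr_elem A p g = gr_elem A p (f \<oplus> g)"
  using assms coset_add[OF zero_closed zero_closed]
  by (auto simp: fun_eq_iff gr_elem_apply gr_add coset_add)

text \<open>Well-definedness of the product: for \<open>a = a' + f\<close> and
  \<open>b = b' + g\<close> the difference \<open>a b - f g\<close> equals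
  \<open>a' b + f b'\<close>, and multiplicativity of the filtration puts both terms into
  F_{k-1}.\<close>

lemma rcoset_mult_coset:
  assumes f: "f \<in> filt A (int i)" and g: "g \<in> filt A (int j)" and k: "i + j = k"
  shows "rcoset_mult A (filt A (int k - 1)) (filt A (int i - 1) +> f) (filt A (int j - 1) +> g) =
    filt A (int k - 1) +> (f \<otimes> g)"
proof -
  have "filt A (int k - 1) +> (a \<otimes> b) = filt A (int k - 1) +> (f \<otimes> g)"
    if a: "a \<in> filt A (int i - 1) +> f" and b: "b \<in> filt A (int j - 1) +> g" for a b
  proof -
    from a obtain a' where a': "a' \<in> filt A (int i - 1)" "a = a' \<oplus> f" by (auto simp: a_r_coset_def')
    from b obtain b' where b': "b' \<in> filt A (int j - 1)" "b = b' \<oplus> g" by (auto simp: a_r_coset_def')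
    note cl = filt_closed[OF f] filt_closed[OF g] filt_closed[OF a'(1)] filt_closed[OF b'(1)]
    have "b' \<in> filt A (int j)" using b'(1) by (rule filt_mono) simp
    then have b2: "b \<in> filt A (int j)" using filt_add g b'(2) by simp
    have "a' \<otimes> b \<in> filt A (int k - 1)" "f \<otimes> b' \<in> filt A (int k - 1)"
      using filt_mult[OF a'(1) b2] filt_mult[OF f b'(1)] k by (auto simp: algebra_simps)
    then have "a' \<otimes> b \<oplus> f \<otimes> b' \<in> filt A (int k - 1)" by (rule filt_add)
    moreover have "a \<otimes> b = a' \<otimes> b \<oplus> f \<otimes> b' \<oplus> f \<otimes> g"
      using cl unfolding a'(2) b'(2) by (simp add: l_distr r_distr a_ac)
    then have "a \<otimes> b \<ominus> f \<otimes> g = a' \<otimes> b \<oplus> f \<otimes> b'"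
      using cl filt_closed[OF b2] by (simp add: a_minus_def a_assoc r_neg)
    ultimately show ?thesis
      using cl a'(2) b'(2) by (subst coset_eq_iff) auto
  qed
  moreover have "f \<in> filt A (int i - 1) +> f" "g \<in> filt A (int j - 1) +> g"
    using abelian_subgroup.a_rcos_self[OF filt_subgroup] filt_closed f g by auto
  ultimately show ?thesis unfolding rcoset_mult_def by blast
qed

text \<open>Both factors are concentrated in one degree, so the convolution sum has at most one
  nontrivial term: \<open>i = p\<close>, with \<open>k - p = q\<close>.\<close>

lemma gr_elem_mult:
  assumes f: "f \<in> filt A (int p)" and g: "g \<in> filt A (int q)"
  shows "gr_elem A p f \<otimes>\<^bsub>gr A\<^esub> gr_elem A q g = gr_elem A (p + q) (f \<otimes> g)"
proof
  fix k
  interpret M: comm_monoid "gr_comp A k" by (rule gr_comp_monoid)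
  let ?F = "\<lambda>i. if i = p then f else \<zero>" and ?G = "\<lambda>i. if i = q then g else \<zero>"
  let ?t = "\<lambda>i. filt A (int k - 1) +> (?F i \<otimes> ?G (k - i))"
  have F: "?F i \<in> filt A (int i)" and G: "?G i \<in> filt A (int i)" for i
    using f g filt_zero by auto
  have t: "rcoset_mult A (filt A (int k - 1)) (gr_elem A p f i) (gr_elem A q g (k - i)) = ?t i"
    if "i \<le> k" for i
    unfolding gr_elem_apply by (rule rcoset_mult_coset[OF F G]) (use that in simp)
  have single: "finprod (gr_comp A k) h {p} = h p" if "h p \<in> carrier (gr_comp A k)" for h
    using that by simp
  have tc: "?t i \<in> carrier (gr_comp A k)" if "i \<le> k" for i
    using filt_mult[OF F[of i] G[of "k - i"]] that by (auto simp: gr_comp_carrier of_nat_diff)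
  have "(gr_elem A p f \<otimes>\<^bsub>gr A\<^esub> gr_elem A q g) k = finprod (gr_comp A k)
     (\<lambda>i. rcoset_mult A (filt A (int k - 1)) (gr_elem A p f i) (gr_elem A q g (k - i))) {..k}"
    by (simp add: gr_def)
  also have "\<dots> = finprod (gr_comp A k) ?t {..k}"
    by (rule M.finprod_cong') (use t tc in auto)
  also have "\<dots> = gr_elem A (p + q) (f \<otimes> g) k"
  proof (cases "k = p + q")
    case True
    have "finprod (gr_comp A k) ?t {..k} = finprod (gr_comp A k) ?t {p}"
      by (rule M.finprod_mono_neutral_cong_right)
        (use True tc f g filt_closed in \<open>auto simp: gr_comp_one\<close>)
    also have "\<dots> = ?t p"
      using tc[of p] True 
      by (intro single) auto
    finally show ?thesis using True by (simp add: gr_elem_apply)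
  next
    case False
    have "finprod (gr_comp A k) ?t {..k} = \<one>\<^bsub>gr_comp A k\<^esub>"
      by (rule M.finprod_one_eqI) (use False f g filt_closed in \<open>auto simp: gr_comp_one\<close>)
    then show ?thesis using False by (simp add: gr_elem_apply gr_comp_one)
  qed
  finally show "(gr_elem A p f \<otimes>\<^bsub>gr A\<^esub> gr_elem A q g) k = gr_elem A (p + q) (f \<otimes> g) k" .
qed

lemma gr_base: "base (gr A) = gr_elem A 0 ` base A"
  by (auto simp: gr_def gr_comp_carrier gr_elem_def filt_0)

text \<open>Degree 0 is taken modulo F_{-1} = 0, so nothing is identified. This injectivity later
  carries ideal membership from Gr(A) back to R.\<close>

lemma gr_elem_0_eq_iff: "r \<in> base A \<Longrightarrow> s \<in> base A \<Longrightarrow> gr_elem A 0 r = gr_elem A 0 s \<longleftrightarrow> r = s"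
  by (simp add: gr_elem_eq_iff base_closed filt_m1)

lemma gr_elem_0_eq_zero_iff: "r \<in> base A \<Longrightarrow> gr_elem A 0 r = \<zero>\<^bsub>gr A\<^esub> \<longleftrightarrow> r = \<zero>"
  by (simp add: gr_elem_eq_zero_iff base_closed filt_m1)

text \<open>Stated for one component because the summands may lie in different degrees; component
  \<open>q\<close> collects exactly those of degree \<open>q\<close>.\<close>

lemma gr_elem_finsum:
  assumes "\<And>i. i \<in> S \<Longrightarrow> f i \<in> filt A (int (d i))"
  shows "(\<Oplus>\<^bsub>gr A\<^esub>i\<in>S. gr_elem A (d i) (f i)) q =
    filt A (int q - 1) +> (\<Oplus>i\<in>S. if d i = q then f i else \<zero>)"
proof -
  interpret gr: abelian_monoid "gr A" by (rule gr_abelian_monoid)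
  show ?thesis
    using assms
  proof (induction S rule: infinite_finite_induct)
    case (insert i S)
    note fc = filt_closed[OF insert.prems]
    let ?g = "\<lambda>i. if d i = q then f i else \<zero>"
    have g: "?g \<in> S \<rightarrow> carrier A" "?g i \<in> carrier A" using fc by auto
    have "(\<Oplus>\<^bsub>gr A\<^esub>i\<in>insert i S. gr_elem A (d i) (f i)) q =
        gr_elem A (d i) (f i) q <+> (\<Oplus>\<^bsub>gr A\<^esub>i\<in>S. gr_elem A (d i) (f i)) q"
      using insert.hyps insert.prems
      by (subst gr.finsum_insert) (auto simp: gr_elem_carrier gr_add)
    also have "gr_elem A (d i) (f i) q = filt A (int q - 1) +> ?g i"
      by (simp add: gr_elem_apply eq_commute)
    also have "(\<Oplus>\<^bsub>gr A\<^esub>i\<in>S. gr_elem A (d i) (f i)) q = filt A (int q - 1) +> (\<Oplus>i\<in>S. ?g i)"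
      using insert.IH insert.prems by blast
    also have "filt A (int q - 1) +> ?g i <+> (filt A (int q - 1) +> (\<Oplus>i\<in>S. ?g i)) =
        filt A (int q - 1) +> (?g i \<oplus> (\<Oplus>i\<in>S. ?g i))"
      by (rule coset_add[OF g(2) finsum_closed[OF g(1)]])
    also have "?g i \<oplus> (\<Oplus>i\<in>S. ?g i) = (\<Oplus>i\<in>insert i S. ?g i)"
      by (rule finsum_insert[OF insert.hyps g, symmetric])
    finally show ?case .
  qed (auto simp: gr_zero)
qed

section \<open>Symbols of variables and monomials\<close>

lemma xpow_monomial: "xpow A \<alpha> = \<one> \<otimes> xpow A \<alpha>"
  using xpow_closed by simp

text \<open>The coefficient 1 counts towards the support exactly when 1 \<noteq> 0.\<close>

lemma supp_xpow: "\<one> \<noteq> \<zero> \<Longrightarrow> \<alpha> \<in> exponents A \<Longrightarrow> supp A (xpow A \<alpha>) = {\<alpha>}"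
  by (subst xpow_monomial) (auto simp: supp_def coeff_of_monomial base_one)

lemma pdeg_xpow: "\<one> \<noteq> \<zero> \<Longrightarrow> \<alpha> \<in> exponents A \<Longrightarrow> pdeg A (xpow A \<alpha>) = exp_size A \<alpha>"
  by (simp add: pdeg_def supp_xpow)

lemma xpow_inj: "\<one> \<noteq> \<zero> \<Longrightarrow> inj_on (xpow A) (exponents A)"
  by (metis inj_onI supp_xpow singleton_inject)

text \<open>The variables of Gr(A) are symbols, so their degree must be known to be 1; this follows
  by viewing a variable as a monomial.\<close>

lemma var_eq_xpow:
  assumes "i < nvars A" shows "var A i = xpow A ((\<lambda>_. 0)(i := 1))"
  using var_mult_xpow[OF assms, of "\<lambda>_. 0"] var_closed[OF assms] by (simp add: xpow_zero)

lemma var_filt: "i < nvars A \<Longrightarrow> var A i \<in> filt A 1"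
  using var_mult_filt[of i \<one> 0] var_closed by (simp add: filt_0 base_one)

lemma pow_filt: "x \<in> filt A 1 \<Longrightarrow> x [^] n \<in> filt A (int n)"
proof (induction n)
  case (Suc n)
  then show ?case using filt_mult[of "x [^] n" "int n" x 1] by (simp add: add.commute)
qed (simp add: filt_0 base_one)

lemma gr_elem_pow: "x \<in> filt A 1 \<Longrightarrow> gr_elem A 1 x [^]\<^bsub>gr A\<^esub> (n::nat) = gr_elem A n (x [^] n)"
proof (induction n)
  case 0
  show ?case by (simp add: nat_pow_def gr_one)
next
  case (Suc n)
  have "gr_elem A 1 x [^]\<^bsub>gr A\<^esub> Suc n = gr_elem A 1 x [^]\<^bsub>gr A\<^esub> n \<otimes>\<^bsub>gr A\<^esub> gr_elem A 1 x"
    by (simp add: nat_pow_def)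
  then show ?case
    using Suc gr_elem_mult[OF pow_filt[OF Suc.prems], of x 1 n] by simp
qed

lemma symbol_xpow:
  "\<one> \<noteq> \<zero> \<Longrightarrow> \<alpha> \<in> exponents A \<Longrightarrow> symbol A (xpow A \<alpha>) = gr_elem A (exp_size A \<alpha>) (xpow A \<alpha>)"
  by (simp add: symbol_eq_gr_elem pdeg_xpow)

lemma symbol_var:
  assumes "\<one> \<noteq> \<zero>" "i < nvars A"
  shows "symbol A (var A i) = gr_elem A 1 (var A i)"
proof -
  have "exp_size A ((\<lambda>_. 0)(i := 1)) = 1"
    using exp_size_upd[OF assms(2), of "\<lambda>_. 0"] by (simp add: exp_size_def)
  then show ?thesis
    using symbol_xpow[OF assms(1) upd_exponents[OF assms(2) zero_exponents, of 1]]
      var_eq_xpow[OF assms(2)] by simp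
qed

lemma gr_xpow:
  assumes "\<one> \<noteq> \<zero>"
  shows "xpow (gr A) \<alpha> = gr_elem A (exp_size A \<alpha>) (xpow A \<alpha>)"
proof -
  \<comment> \<open>The filtration level is carried along because \<open>gr_elem_mult\<close>
    requires each factor to lie in the level at which its class is taken.\<close>
  have "k \<le> nvars A \<Longrightarrow> var_prod A \<alpha> k \<in> filt A (int (\<Sum>i<k. \<alpha> i)) \<and>
      var_prod (gr A) \<alpha> k = gr_elem A (\<Sum>i<k. \<alpha> i) (var_prod A \<alpha> k)" for k
  proof (induction k)
    case 0
    show ?case by (simp add: gr_one filt_0 base_one)
  next
    case (Suc k)
    have "var (gr A) k = gr_elem A 1 (var A k)"
      using symbol_var[OF assms] Suc.prems by (simp add: gr_def)
    moreover have p: "var A k [^] \<alpha> k \<in> filt A (int (\<alpha> k))" and v: "var A k \<in> filt A 1"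
      using pow_filt var_filt Suc.prems by auto
    ultimately show ?case
      using Suc filt_mult[OF _ p] gr_elem_mult[OF _ p] gr_elem_pow[OF v] by simp
  qed
  then show ?thesis by (simp add: xpow_def exp_size_def)
qed

lemma gr_monomial:
  assumes "\<one> \<noteq> \<zero>" "r \<in> base A" "\<alpha> \<in> exponents A"
  shows "gr_elem A 0 r \<otimes>\<^bsub>gr A\<^esub> xpow (gr A) \<alpha> = gr_elem A (exp_size A \<alpha>) (r \<otimes> xpow A \<alpha>)"
  using assms gr_elem_mult[of r 0 "xpow A \<alpha>" "exp_size A \<alpha>"] filt_xpow
  by (simp add: gr_xpow filt_0)

section \<open>Coefficient families in Gr(A)\<close>

definition homog_coeffs :: "nat \<Rightarrow> ((nat \<Rightarrow> nat) \<Rightarrow> 'a) \<Rightarrow> (nat \<Rightarrow> nat) \<Rightarrow> 'a" where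
  "homog_coeffs q c = (\<lambda>\<alpha>. if exp_size A \<alpha> = q then c \<alpha> else \<zero>)"

lemma homog_coeffs_family: "c \<in> coeff_families A \<Longrightarrow> homog_coeffs q c \<in> coeff_families A"
proof -
  assume c: "c \<in> coeff_families A"
  have "{\<alpha>. homog_coeffs q c \<alpha> \<noteq> \<zero>} \<subseteq> {\<alpha>. c \<alpha> \<noteq> \<zero>}" by (auto simp: homog_coeffs_def)
  then show ?thesis
    using c finite_subset[of "{\<alpha>. homog_coeffs q c \<alpha> \<noteq> \<zero>}"] base_zero
    by (simp add: coeff_families_def) (auto simp: homog_coeffs_def)
qed

lemma gr_coeff_families: "coeff_families (gr A) = (\<lambda>c \<alpha>. gr_elem A 0 (c \<alpha>)) ` coeff_families A"
proof (intro subset_antisym subsetI)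
  fix d assume "d \<in> coeff_families (gr A)"
  then have d: "\<forall>\<alpha>. \<exists>r\<in>base A. d \<alpha> = gr_elem A 0 r" "{\<alpha>. d \<alpha> \<noteq> \<zero>\<^bsub>gr A\<^esub>} \<subseteq> exponents A"
    "finite {\<alpha>. d \<alpha> \<noteq> \<zero>\<^bsub>gr A\<^esub>}"
    by (auto simp: coeff_families_def gr_base)
  from d(1) obtain c where c: "\<And>\<alpha>. c \<alpha> \<in> base A" "d = (\<lambda>\<alpha>. gr_elem A 0 (c \<alpha>))" by metis
  then show "d \<in> (\<lambda>c \<alpha>. gr_elem A 0 (c \<alpha>)) ` coeff_families A"
    using d(2,3) by (auto simp: coeff_families_def gr_elem_0_eq_zero_iff)
qed (auto simp: coeff_families_def gr_base gr_elem_0_eq_zero_iff)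

text \<open>The term at \<open>\<alpha>\<close> lives in degree \<open>exp_size A \<alpha>\<close>,
  so component \<open>q\<close> sees only the exponents of size \<open>q\<close>.\<close>

lemma gr_lincomb_apply:
  assumes "\<one> \<noteq> \<zero>" and c: "c \<in> coeff_families A"
  shows "lincomb (gr A) (\<lambda>\<alpha>. gr_elem A 0 (c \<alpha>)) q =
    filt A (int q - 1) +> lincomb A (homog_coeffs q c)"
proof -
  interpret gr: abelian_monoid "gr A" by (rule gr_abelian_monoid)
  let ?S = "{\<alpha>. c \<alpha> \<noteq> \<zero>}"
  note cd = coeff_familiesD[OF c]
  have S: "\<alpha> \<in> exponents A" if "\<alpha> \<in> ?S" for \<alpha> using that cd(2) by auto
  have "lincomb (gr A) (\<lambda>\<alpha>. gr_elem A 0 (c \<alpha>)) =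
    (\<Oplus>\<^bsub>gr A\<^esub>\<alpha>\<in>?S. gr_elem A 0 (c \<alpha>) \<otimes>\<^bsub>gr A\<^esub> xpow (gr A) \<alpha>)"
    by (simp add: lincomb_def gr_elem_0_eq_zero_iff cd(1))
  also have "\<dots> = (\<Oplus>\<^bsub>gr A\<^esub>\<alpha>\<in>?S. gr_elem A (exp_size A \<alpha>) (c \<alpha> \<otimes> xpow A \<alpha>))"
    using S assms(1) cd(1)
    by (intro gr.add.finprod_cong') (auto simp: gr_monomial intro!: gr_elem_carrier filt_monomial)
  finally have "lincomb (gr A) (\<lambda>\<alpha>. gr_elem A 0 (c \<alpha>)) q =
    filt A (int q - 1) +> (\<Oplus>\<alpha>\<in>?S. if exp_size A \<alpha> = q then c \<alpha> \<otimes> xpow A \<alpha> else \<zero>)"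
    using S cd(1) filt_monomial
    by (subst gr_elem_finsum[where f = "\<lambda>\<alpha>. c \<alpha> \<otimes> xpow A \<alpha>", symmetric]) auto
  also have "(\<Oplus>\<alpha>\<in>?S. if exp_size A \<alpha> = q then c \<alpha> \<otimes> xpow A \<alpha> else \<zero>) =
      (\<Oplus>\<alpha>\<in>?S. homog_coeffs q c \<alpha> \<otimes> xpow A \<alpha>)"
    using cd(1) base_closed xpow_closed
    by (intro add.finprod_cong') (auto simp: homog_coeffs_def)
  also have "\<dots> = lincomb A (homog_coeffs q c)"
    using cd(1,3) homog_coeffs_family[OF c]
    by (intro lincomb_superset[symmetric]) (auto simp: homog_coeffs_def base_zero)
  finally show ?thesis .
qed

text \<open>Modulo F_{q-1} only coefficients at sizes \<open>q\<close> and above matter, and above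
  \<open>q\<close> both sides have none. So the monomials of size \<open>q\<close> give a basis of
  Gr(A)_q over R.\<close>

lemma coset_lincomb_eq_iff:
  assumes f: "f \<in> filt A (int q)" and c: "c \<in> coeff_families A"
  shows "filt A (int q - 1) +> f = filt A (int q - 1) +> lincomb A (homog_coeffs q c) \<longleftrightarrow>
    (\<forall>\<alpha>. exp_size A \<alpha> = q \<longrightarrow> coeff_of A f \<alpha> = c \<alpha>)"
proof -
  note h = homog_coeffs_family[OF c, of q]
  have fc: "f \<in> carrier A" by (rule filt_closed[OF f])
  have k: "coeff_of A (f \<ominus> lincomb A (homog_coeffs q c)) \<alpha> = coeff_of A f \<alpha> \<ominus> homog_coeffs q c \<alpha>" for \<alpha>
    using fc h by (simp add: coeff_of_minus lincomb_closed coeff_of_lincomb)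
  have z: "coeff_of A f \<alpha> \<ominus> homog_coeffs q c \<alpha> = \<zero> \<longleftrightarrow> coeff_of A f \<alpha> = homog_coeffs q c \<alpha>" for \<alpha>
    using coeff_of_closed[OF fc] base_closed[OF coeff_familiesD(1)[OF h]] by simp
  have "f \<ominus> lincomb A (homog_coeffs q c) \<in> filt A (int q - 1) \<longleftrightarrow>
    (\<forall>\<alpha>. coeff_of A f \<alpha> \<noteq> homog_coeffs q c \<alpha> \<longrightarrow> exp_size A \<alpha> < q)"
    using fc lincomb_closed[OF h] by (auto simp: filt_iff supp_def k z)
  also have "\<dots> \<longleftrightarrow> (\<forall>\<alpha>. exp_size A \<alpha> = q \<longrightarrow> coeff_of A f \<alpha> = c \<alpha>)"
  proof (intro iffI allI impI)
    \<comment> \<open>The two coefficients can differ only off size \<open>q\<close>. There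
      \<open>homog_coeffs\<close> is zero, so \<open>\<alpha>\<close> occurs in \<open>f\<close>,
      and \<open>f\<close> in F_q leaves only sizes below \<open>q\<close>.\<close>
    fix \<alpha> assume *: "\<forall>\<alpha>. exp_size A \<alpha> = q \<longrightarrow> coeff_of A f \<alpha> = c \<alpha>"
      "coeff_of A f \<alpha> \<noteq> homog_coeffs q c \<alpha>"
    then have ne: "exp_size A \<alpha> \<noteq> q" by (auto simp: homog_coeffs_def)
    then have "\<alpha> \<in> supp A f" using *(2) by (auto simp: homog_coeffs_def supp_def)
    then have "exp_size A \<alpha> \<le> q" using f by (auto simp: filt_iff)
    then show "exp_size A \<alpha> < q" using ne by simp
  next
    fix \<alpha> assume "\<forall>\<alpha>. coeff_of A f \<alpha> \<noteq> homog_coeffs q c \<alpha> \<longrightarrow> exp_size A \<alpha> < q" "exp_size A \<alpha> = q"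
    then have "coeff_of A f \<alpha> = homog_coeffs q c \<alpha>" by blast
    then show "coeff_of A f \<alpha> = c \<alpha>" using \<open>exp_size A \<alpha> = q\<close> by (simp add: homog_coeffs_def)
  qed
  finally show ?thesis using coset_eq_iff[OF fc lincomb_closed[OF h]] by simp
qed

lemma lincomb_homog_filt:
  assumes c: "c \<in> coeff_families A" shows "lincomb A (homog_coeffs q c) \<in> filt A (int q)"
proof -
  note h = homog_coeffs_family[OF c, of q]
  show ?thesis
    using lincomb_closed[OF h] by (auto simp: filt_iff supp_def coeff_of_lincomb[OF h])
      (auto simp: homog_coeffs_def split: if_splits)
qed

text \<open>The coefficient at \<open>\<alpha>\<close> is visible in the component of degree
  \<open>exp_size A \<alpha>\<close>, so comparing that component suffices.\<close>

lemma gr_lincomb_inj: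
  assumes one: "\<one> \<noteq> \<zero>" and c: "c \<in> coeff_families A" and c': "c' \<in> coeff_families A"
    and eq: "lincomb (gr A) (\<lambda>\<alpha>. gr_elem A 0 (c \<alpha>)) = lincomb (gr A) (\<lambda>\<alpha>. gr_elem A 0 (c' \<alpha>))"
  shows "c = c'"
proof
  fix \<alpha>
  let ?q = "exp_size A \<alpha>"
  have "filt A (int ?q - 1) +> lincomb A (homog_coeffs ?q c) =
      filt A (int ?q - 1) +> lincomb A (homog_coeffs ?q c')"
    using fun_cong[OF eq, of ?q] gr_lincomb_apply[OF one] c c' by simp
  then have "coeff_of A (lincomb A (homog_coeffs ?q c)) \<alpha> = c' \<alpha>"
    using coset_lincomb_eq_iff[OF lincomb_homog_filt[OF c] c'] by blast
  then show "c \<alpha> = c' \<alpha>"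
    by (simp only: coeff_of_lincomb[OF homog_coeffs_family[OF c]]) (simp add: homog_coeffs_def)
qed

lemma gr_coeff_of:
  assumes "\<one> \<noteq> \<zero>" "c \<in> coeff_families A" "u = lincomb (gr A) (\<lambda>\<alpha>. gr_elem A 0 (c \<alpha>))"
  shows "coeff_of (gr A) u = (\<lambda>\<alpha>. gr_elem A 0 (c \<alpha>))"
  unfolding coeff_of_def
proof (rule the_equality)
  fix d assume "d \<in> coeff_families (gr A) \<and> u = lincomb (gr A) d"
  then obtain c' where c': "c' \<in> coeff_families A" "d = (\<lambda>\<alpha>. gr_elem A 0 (c' \<alpha>))"
    "u = lincomb (gr A) (\<lambda>\<alpha>. gr_elem A 0 (c' \<alpha>))"
    unfolding gr_coeff_families by auto
  have "c = c'" by (rule gr_lincomb_inj[OF assms(1,2) c'(1)]) (use assms(3) c'(3) in simp)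
  with c'(2) show "d = (\<lambda>\<alpha>. gr_elem A 0 (c \<alpha>))" by simp
qed (use assms in \<open>auto simp: gr_coeff_families\<close>)

text \<open>Recognises an element from any choice of representatives \<open>f q\<close> of its
  components: the coefficient at \<open>\<alpha>\<close> is read off from the representative in the
  degree of \<open>\<alpha>\<close>.\<close>

lemma gr_eq_lincombI:
  assumes "\<one> \<noteq> \<zero>" "c \<in> coeff_families A" "\<And>q. f q \<in> filt A (int q)"
    "\<And>q. u q = filt A (int q - 1) +> f q"
    "\<And>\<alpha>. coeff_of A (f (exp_size A \<alpha>)) \<alpha> = c \<alpha>"
  shows "u = lincomb (gr A) (\<lambda>\<alpha>. gr_elem A 0 (c \<alpha>))"
proof
  fix q
  have "filt A (int q - 1) +> f q = filt A (int q - 1) +> lincomb A (homog_coeffs q c)"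
    using assms(2,3,5) by (subst coset_lincomb_eq_iff) auto
  then show "u q = lincomb (gr A) (\<lambda>\<alpha>. gr_elem A 0 (c \<alpha>)) q"
    using gr_lincomb_apply[OF assms(1,2)] assms(4) by simp
qed

lemma gr_lincomb_ex:
  assumes one: "\<one> \<noteq> \<zero>" and u: "u \<in> carrier (gr A)"
  obtains c where "c \<in> coeff_families A" "u = lincomb (gr A) (\<lambda>\<alpha>. gr_elem A 0 (c \<alpha>))"
proof -
  have "\<exists>f. f \<in> filt A (int q) \<and> u q = filt A (int q - 1) +> f" for q
  proof -
    have "u q \<in> carrier (gr_comp A q)" using u by (simp add: gr_carrier)
    then show ?thesis by (rule gr_compE) blast
  qed
  then obtain f where f: "\<And>q. f q \<in> filt A (int q)" "\<And>q. u q = filt A (int q - 1) +> f q"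
    by metis
  note fc = filt_closed[OF f(1)]
  define c where "c = (\<lambda>\<alpha>. coeff_of A (f (exp_size A \<alpha>)) \<alpha>)"
  let ?Q = "{q. u q \<noteq> filt A (int q - 1)}"
  \<comment> \<open>Finiteness: a nonzero \<open>c \<alpha>\<close> keeps the representative in that
    degree out of the next lower level, so the component is nonzero. There are finitely many such
    components, each with a representative of finite support.\<close>
  have sub: "{\<alpha>. c \<alpha> \<noteq> \<zero>} \<subseteq> (\<Union>q\<in>?Q. supp A (f q))"
  proof
    fix \<alpha> assume "\<alpha> \<in> {\<alpha>. c \<alpha> \<noteq> \<zero>}"
    then have \<alpha>: "\<alpha> \<in> supp A (f (exp_size A \<alpha>))" by (simp add: c_def supp_def)
    then have "f (exp_size A \<alpha>) \<notin> filt A (int (exp_size A \<alpha>) - 1)" by (auto simp: filt_iff)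
    then have "exp_size A \<alpha> \<in> ?Q" using f(2) coset_eq_filt_iff fc by auto
    with \<alpha> show "\<alpha> \<in> (\<Union>q\<in>?Q. supp A (f q))" by blast
  qed
  have "finite (\<Union>q\<in>?Q. supp A (f q))" using u finite_supp fc by (auto simp: gr_carrier)
  from finite_subset[OF sub this] have "c \<in> coeff_families A"
    using sub supp_exponents[OF fc] coeff_of_base[OF fc] by (fastforce simp: coeff_families_def c_def)
  then show ?thesis using that gr_eq_lincombI[OF one _ f, of c] c_def by blast
qed

text \<open>Disposes of the remainders in the descriptions of \<open>sigma\<close> and
  \<open>cmul\<close> over Gr(A): they become invisible in the component of the leading
  term.\<close>

lemma gr_low_component:
  assumes one: "\<one> \<noteq> \<zero>" and u: "u \<in> carrier (gr A)"
    and low: "u = \<zero>\<^bsub>gr A\<^esub> \<or> pdeg (gr A) u < n"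
  shows "u n = filt A (int n - 1)"
proof (cases "u = \<zero>\<^bsub>gr A\<^esub>")
  case True
  then show ?thesis by (simp add: gr_zero)
next
  case False
  obtain c where c: "c \<in> coeff_families A" "u = lincomb (gr A) (\<lambda>\<alpha>. gr_elem A 0 (c \<alpha>))"
    using gr_lincomb_ex[OF one u] .
  have supp: "supp (gr A) u = {\<alpha>. c \<alpha> \<noteq> \<zero>}"
    unfolding supp_def gr_coeff_of[OF one c] using coeff_familiesD(1)[OF c(1)] gr_elem_0_eq_zero_iff by auto
  have "c \<alpha> = \<zero>" if "exp_size A \<alpha> = n" for \<alpha>
  proof (rule ccontr)
    assume "c \<alpha> \<noteq> \<zero>"
    then have "exp_size A \<alpha> \<le> pdeg (gr A) u"
      unfolding pdeg_def supp using coeff_familiesD(3)[OF c(1)] by (intro Max_ge) auto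
    then show False using low False that by simp
  qed
  then have "homog_coeffs n c = (\<lambda>_. \<zero>)" by (auto simp: homog_coeffs_def)
  then have "lincomb A (homog_coeffs n c) = \<zero>" by (simp add: lincomb_def)
  then show ?thesis using gr_lincomb_apply[OF one c(1)] c(2) by simp
qed

end


section \<open>Leading terms and reductions\<close>

text \<open>The common pattern of \<open>sigma\<close> and \<open>cmul\<close>: the coefficient of
  \<open>x^\<gamma>\<close> in \<open>y\<close> modulo lower degree, as the same definite
  description.\<close>

definition lead_coeff :: "('a, 'm) pbw_scheme \<Rightarrow> 'a \<Rightarrow> (nat \<Rightarrow> nat) \<Rightarrow> 'a" where
  "lead_coeff A y \<gamma> = (THE s. s \<in> base A \<and> (\<exists>p\<in>carrier A.
     y = s \<otimes>\<^bsub>A\<^esub> xpow A \<gamma> \<oplus>\<^bsub>A\<^esub> p \<and> (p = \<zero>\<^bsub>A\<^esub> \<or> pdeg A p < exp_size A \<gamma>)))"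

lemma sigma_eq_lead_coeff: "sigma A \<alpha> r = lead_coeff A (xpow A \<alpha> \<otimes>\<^bsub>A\<^esub> r) \<alpha>"
  by (simp add: sigma_def lead_coeff_def)

lemma cmul_eq_lead_coeff: "cmul A \<alpha> \<beta> = lead_coeff A (xpow A \<alpha> \<otimes>\<^bsub>A\<^esub> xpow A \<beta>) (exp_add \<alpha> \<beta>)"
  by (simp add: cmul_def lead_coeff_def)

text \<open>Antisymmetry makes the greatest element unique. This lemma and the next are stated for
  arbitrary structures so that they apply to \<open>A\<close> and to \<open>gr A\<close>
  alike.\<close>

lemma lm_eqI:
  assumes "antisym ord" "\<mu> \<in> supp A f" "\<And>\<alpha>. \<alpha> \<in> supp A f \<Longrightarrow> (xpow A \<alpha>, xpow A \<mu>) \<in> ord"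
  shows "lm A ord f = xpow A \<mu>"
  unfolding lm_def using assms by (intro the_equality) (auto dest: antisymD)

lemma mon_exp_xpow:
  assumes "inj_on (xpow A) (exponents A)" "\<mu> \<in> exponents A" shows "mon_exp A (xpow A \<mu>) = \<mu>"
  unfolding mon_exp_def using assms by (intro the_equality) (auto dest: inj_onD)

context skew_PBW
begin

section \<open>Leading terms of an element and of its symbol\<close>

lemma supp_nonempty: "f \<in> carrier A \<Longrightarrow> f \<noteq> \<zero> \<Longrightarrow> supp A f \<noteq> {}"
  using coeff_of_eqI[of f \<zero>] by (auto simp: supp_def coeff_of_zero)

text \<open>Translates the remainder condition of \<open>sigma\<close> and \<open>cmul\<close> into
  the filtration; the integer index \<open>n - 1\<close> also covers \<open>n = 0\<close>, where
  only zero is left.\<close>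

lemma filt_pdeg_iff:
  assumes "f \<in> carrier A"
  shows "f \<in> filt A (int n - 1) \<longleftrightarrow> f = \<zero> \<or> pdeg A f < n"
proof (cases "f = \<zero>")
  case False
  have "pdeg A f < n \<longleftrightarrow> (\<forall>\<alpha>\<in>supp A f. exp_size A \<alpha> < n)"
    unfolding pdeg_def using finite_supp supp_nonempty assms False by (subst Max_less_iff) auto
  also have "\<dots> \<longleftrightarrow> f \<in> filt A (int n - 1)" using assms by (auto simp: filt_iff)
  finally show ?thesis using False by simp
qed (simp add: filt_zero)

lemma pdeg_filt: "f \<in> carrier A \<Longrightarrow> f \<in> filt A (int (pdeg A f))"
  using filt_pdeg_iff[of f "Suc (pdeg A f)"] by simp

lemma symbol_eq_zero_iff:
  assumes "f \<in> carrier A" shows "symbol A f = \<zero>\<^bsub>gr A\<^esub> \<longleftrightarrow> f = \<zero>"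
  using assms by (simp add: symbol_eq_gr_elem gr_elem_eq_zero_iff filt_pdeg_iff)

lemma symbol_closed: "f \<in> carrier A \<Longrightarrow> symbol A f \<in> carrier (gr A)"
  by (simp add: symbol_eq_gr_elem gr_elem_carrier pdeg_filt)

lemma coeff_of_symbol:
  assumes one: "\<one> \<noteq> \<zero>" and f: "f \<in> carrier A"
  shows "coeff_of (gr A) (symbol A f) =
    (\<lambda>\<alpha>. gr_elem A 0 (homog_coeffs (pdeg A f) (coeff_of A f) \<alpha>))"
proof (rule gr_coeff_of[OF one])
  let ?c = "homog_coeffs (pdeg A f) (coeff_of A f)"
  show c: "?c \<in> coeff_families A" by (rule homog_coeffs_family[OF coeff_of_family[OF f]])
  show "symbol A f = lincomb (gr A) (\<lambda>\<alpha>. gr_elem A 0 (?c \<alpha>))"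
    \<comment> \<open>Representatives: \<open>f\<close> itself in its own degree and zero in all
      others.\<close>
    by (rule gr_eq_lincombI[OF one c, of "\<lambda>q. if q = pdeg A f then f else \<zero>"])
      (use f pdeg_filt filt_zero in
        \<open>auto simp: symbol_eq_gr_elem gr_elem_apply homog_coeffs_def coeff_of_zero\<close>)
qed

lemma supp_symbol:
  assumes one: "\<one> \<noteq> \<zero>" and f: "f \<in> carrier A"
  shows "supp (gr A) (symbol A f) = {\<alpha> \<in> supp A f. exp_size A \<alpha> = pdeg A f}"
proof -
  have "homog_coeffs (pdeg A f) (coeff_of A f) \<alpha> \<in> base A" for \<alpha>
    by (rule coeff_familiesD(1)[OF homog_coeffs_family[OF coeff_of_family[OF f]]])
  then have "supp (gr A) (symbol A f) = {\<alpha>. homog_coeffs (pdeg A f) (coeff_of A f) \<alpha> \<noteq> \<zero>}"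
    by (simp add: supp_def coeff_of_symbol[OF one f] gr_elem_0_eq_zero_iff)
  then show ?thesis by (auto simp: supp_def homog_coeffs_def)
qed

lemma gr_xpow_symbol: "\<one> \<noteq> \<zero> \<Longrightarrow> \<alpha> \<in> exponents A \<Longrightarrow> xpow (gr A) \<alpha> = symbol A (xpow A \<alpha>)"
  by (simp add: symbol_xpow gr_xpow)

lemma gr_xpow_inj:
  assumes one: "\<one> \<noteq> \<zero>" shows "inj_on (xpow (gr A)) (exponents (gr A))"
proof (rule inj_onI)
  fix \<alpha> \<beta> assume \<alpha>: "\<alpha> \<in> exponents (gr A)" and \<beta>: "\<beta> \<in> exponents (gr A)"
    and eq: "xpow (gr A) \<alpha> = xpow (gr A) \<beta>"
  \<comment> \<open>The exponent is recovered from the monomial as the only element of its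
    support.\<close>
  have "supp (gr A) (xpow (gr A) \<gamma>) = {\<gamma>}" if "\<gamma> \<in> exponents A" for \<gamma>
    using that one
    by (auto simp: gr_xpow_symbol supp_symbol xpow_closed supp_xpow pdeg_xpow)
  then show "\<alpha> = \<beta>" using \<alpha> \<beta> eq by (metis gr_exponents singleton_inject)
qed

text \<open>Two opposite pairs in \<open>gr_order\<close> may come from different pairs of monomials
  of A; injectivity of \<open>symbol\<close> on monomials identifies them.\<close>

lemma gr_order_antisym:
  assumes one: "\<one> \<noteq> \<zero>" and ord: "ord \<subseteq> Mon A \<times> Mon A" "antisym ord"
  shows "antisym (gr_order A ord)"
proof (rule antisymI)
  have inj: "inj_on (symbol A) (Mon A)"
    unfolding Mon_def using gr_xpow_inj[OF one] xpow_inj[OF one]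
    by (intro inj_onI) (auto simp: gr_xpow_symbol[OF one, symmetric] dest: inj_onD)
  fix u v assume "(u, v) \<in> gr_order A ord" "(v, u) \<in> gr_order A ord"
  then obtain a b b' a' where *: "(a, b) \<in> ord" "u = symbol A a" "v = symbol A b"
      "(b', a') \<in> ord" "v = symbol A b'" "u = symbol A a'"
    unfolding gr_order_def by blast
  then have "a \<in> Mon A" "b \<in> Mon A" "a' \<in> Mon A" "b' \<in> Mon A" using ord(1) by auto
  then have "a = a'" "b = b'" using inj_onD[OF inj] * by metis+
  then show "u = v" using * ord(2) by (auto dest: antisymD)
qed

lemma finite_max_exponent:
  assumes lin: "linear_order_on (Mon A) ord" and "finite T" "T \<noteq> {}" "T \<subseteq> exponents A"
  shows "\<exists>\<mu>\<in>T. \<forall>\<alpha>\<in>T. (xpow A \<alpha>, xpow A \<mu>) \<in> ord"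
  using assms(2-4)
proof (induction T rule: finite_ne_induct)
  case (singleton \<alpha>)
  then show ?case using lin by (auto simp: order_on_defs refl_on_def Mon_def)
next
  case (insert \<alpha> T)
  then obtain \<mu> where \<mu>: "\<mu> \<in> T" "\<forall>\<beta>\<in>T. (xpow A \<beta>, xpow A \<mu>) \<in> ord" by auto
  have Mon: "xpow A \<alpha> \<in> Mon A" "xpow A \<mu> \<in> Mon A" using insert.prems \<mu> by (auto simp: Mon_def)
  have refl: "(xpow A \<alpha>, xpow A \<alpha>) \<in> ord" and tr: "trans ord"
    using lin Mon by (auto simp: order_on_defs refl_on_def)
  have "(xpow A \<alpha>, xpow A \<mu>) \<in> ord \<or> (xpow A \<mu>, xpow A \<alpha>) \<in> ord"
    using lin Mon refl by (cases "xpow A \<alpha> = xpow A \<mu>") (auto simp: order_on_defs total_on_def)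
  then show ?case
  proof
    assume "(xpow A \<alpha>, xpow A \<mu>) \<in> ord"
    then show ?thesis using \<mu> by (intro bexI[of _ \<mu>]) auto
  next
    assume "(xpow A \<mu>, xpow A \<alpha>) \<in> ord"
    then show ?thesis using \<mu> refl transD[OF tr] by (intro bexI[of _ \<alpha>]) blast+
  qed
qed

text \<open>By condition (iii) on monomial orders the leading monomial has top degree, so it survives
  in the principal symbol.\<close>
lemma leading_terms:
  assumes one: "\<one> \<noteq> \<zero>" and mo: "monomial_order A ord" and f: "f \<in> carrier A" "f \<noteq> \<zero>"
  shows lm_exp_closed: "mon_exp A (lm A ord f) \<in> exponents A"
    and lc_base: "lc A ord f \<in> base A"
    and lm_exp_symbol: "mon_exp (gr A) (lm (gr A) (gr_order A ord) (symbol A f)) = mon_exp A (lm A ord f)"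
    and lc_symbol: "lc (gr A) (gr_order A ord) (symbol A f) = gr_elem A 0 (lc A ord f)"
proof -
  have lin: "linear_order_on (Mon A) ord" using mo by (simp add: monomial_order_def)
  then have anti: "antisym ord" and sub: "ord \<subseteq> Mon A \<times> Mon A" by (auto simp: order_on_defs)
  obtain \<mu> where \<mu>: "\<mu> \<in> supp A f" "\<And>\<alpha>. \<alpha> \<in> supp A f \<Longrightarrow> (xpow A \<alpha>, xpow A \<mu>) \<in> ord"
    using finite_max_exponent[OF lin finite_supp[OF f(1)] supp_nonempty[OF f] supp_exponents[OF f(1)]]
    by blast
  have \<mu>e: "\<mu> \<in> exponents A" using \<mu>(1) supp_exponents f by blast
  have "exp_size A \<alpha> \<le> exp_size A \<mu>" if "\<alpha> \<in> supp A f" for \<alpha>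
  proof (rule ccontr)
    assume "\<not> exp_size A \<alpha> \<le> exp_size A \<mu>"
    then have "(xpow A \<mu>, xpow A \<alpha>) \<in> ord \<and> xpow A \<mu> \<noteq> xpow A \<alpha>"
      using mo \<mu>e that supp_exponents[OF f(1)] unfolding monomial_order_def by (meson not_le subsetD)
    then show False using \<mu>(2)[OF that] anti by (auto dest: antisymD)
  qed
  then have deg: "exp_size A \<mu> = pdeg A f"
    unfolding pdeg_def using \<mu>(1) finite_supp[OF f(1)] by (intro Max_eqI[symmetric]) auto
  have lm: "lm A ord f = xpow A \<mu>" using lm_eqI[OF anti \<mu>] .
  have me: "mon_exp A (lm A ord f) = \<mu>" unfolding lm by (rule mon_exp_xpow[OF xpow_inj[OF one] \<mu>e])
  have "lm (gr A) (gr_order A ord) (symbol A f) = xpow (gr A) \<mu>"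
  proof (rule lm_eqI[OF gr_order_antisym[OF one sub anti]])
    show "\<mu> \<in> supp (gr A) (symbol A f)" using \<mu>(1) deg by (simp add: supp_symbol[OF one f(1)])
    fix \<alpha> assume "\<alpha> \<in> supp (gr A) (symbol A f)"
    then have \<alpha>: "\<alpha> \<in> supp A f" by (simp add: supp_symbol[OF one f(1)])
    then have "\<alpha> \<in> exponents A" using supp_exponents f by blast
    then show "(xpow (gr A) \<alpha>, xpow (gr A) \<mu>) \<in> gr_order A ord"
      using \<mu>(2)[OF \<alpha>] \<mu>e one by (auto simp: gr_order_def gr_xpow_symbol)
  qed
  then have gme: "mon_exp (gr A) (lm (gr A) (gr_order A ord) (symbol A f)) = \<mu>"
    using mon_exp_xpow[OF gr_xpow_inj[OF one]] \<mu>e by simp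
  show "mon_exp A (lm A ord f) \<in> exponents A"
    "mon_exp (gr A) (lm (gr A) (gr_order A ord) (symbol A f)) = mon_exp A (lm A ord f)"
    using me gme \<mu>e by simp_all
  show "lc A ord f \<in> base A" unfolding lc_def by (rule coeff_of_base[OF f(1)])
  show "lc (gr A) (gr_order A ord) (symbol A f) = gr_elem A 0 (lc A ord f)"
    unfolding lc_def gme me coeff_of_symbol[OF one f(1)] by (simp add: homog_coeffs_def deg)
qed

section \<open>Structure constants in A and in Gr(A)\<close>

lemma coeff_of_mod_filt:
  assumes "y \<in> carrier A" "s \<in> base A" "\<gamma> \<in> exponents A"
    "y \<ominus> s \<otimes> xpow A \<gamma> \<in> filt A (int (exp_size A \<gamma>) - 1)"
  shows "coeff_of A y \<gamma> = s"
proof -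
  \<comment> \<open>\<open>x^\<gamma>\<close> does not occur in elements of degree below the size of
    \<open>\<gamma>\<close>.\<close>
  have "coeff_of A (y \<ominus> s \<otimes> xpow A \<gamma>) \<gamma> = \<zero>"
    using assms(4) by (force simp: filt_iff supp_def)
  then have "coeff_of A y \<gamma> \<ominus> s = \<zero>"
    using assms base_closed xpow_closed by (simp add: coeff_of_minus coeff_of_monomial)
  then show ?thesis using coeff_of_closed assms base_closed by simp
qed

text \<open>In both rings every candidate for the leading coefficient has to agree with the
  coefficient of \<open>y\<close> at \<open>\<gamma>\<close>, since \<open>y\<close> minus the
  leading term lies in the next lower level.\<close>

lemma lead_coeff:
  assumes \<gamma>: "\<gamma> \<in> exponents A" and s: "s \<in> base A"
    and h: "h \<in> filt A (int (exp_size A \<gamma>) - 1)" and y: "y = s \<otimes> xpow A \<gamma> \<oplus> h"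
  shows lead_coeff_eq: "lead_coeff A y \<gamma> = s"
    and gr_lead_coeff_eq: "\<one> \<noteq> \<zero> \<Longrightarrow> lead_coeff (gr A) (gr_elem A (exp_size A \<gamma>) y) \<gamma> = gr_elem A 0 s"
proof -
  have diff: "s' \<otimes> xpow A \<gamma> \<oplus> h' \<ominus> s' \<otimes> xpow A \<gamma> = h'" if "s' \<in> base A" "h' \<in> carrier A" for s' h'
    using that base_closed xpow_closed by (simp add: a_minus_def a_comm[of _ h'] a_assoc r_neg)
  have yc: "y \<in> carrier A" using y s h base_closed xpow_closed filt_closed by simp
  have ys: "coeff_of A y \<gamma> = s"
    using diff[OF s] h filt_closed[OF h] y by (intro coeff_of_mod_filt[OF yc s \<gamma>]) simp
  show "lead_coeff A y \<gamma> = s"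
    unfolding lead_coeff_def
  proof (rule the_equality)
    show "s \<in> base A \<and> (\<exists>p\<in>carrier A. y = s \<otimes> xpow A \<gamma> \<oplus> p \<and> (p = \<zero> \<or> pdeg A p < exp_size A \<gamma>))"
      using s h y filt_closed[OF h] filt_pdeg_iff by blast
    fix s' assume "s' \<in> base A \<and>
      (\<exists>p\<in>carrier A. y = s' \<otimes> xpow A \<gamma> \<oplus> p \<and> (p = \<zero> \<or> pdeg A p < exp_size A \<gamma>))"
    then obtain p where "s' \<in> base A" "p \<in> carrier A" "y = s' \<otimes> xpow A \<gamma> \<oplus> p"
        "p \<in> filt A (int (exp_size A \<gamma>) - 1)"
      using filt_pdeg_iff by blast
    then show "s' = s" using coeff_of_mod_filt[OF yc _ \<gamma>] diff ys by metis
  qed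
  assume one: "\<one> \<noteq> \<zero>"
  interpret gr: abelian_monoid "gr A" by (rule gr_abelian_monoid)
  let ?n = "exp_size A \<gamma>"
  have scl: "s' \<otimes> xpow A \<gamma> \<in> carrier A" if "s' \<in> base A" for s'
    using that base_closed xpow_closed by simp
  show "lead_coeff (gr A) (gr_elem A (exp_size A \<gamma>) y) \<gamma> = gr_elem A 0 s"
    unfolding lead_coeff_def
  proof (rule the_equality)
    \<comment> \<open>The remainder \<open>h\<close> vanishes in degree \<open>?n\<close>, so in
      Gr(A) the decomposition holds with remainder zero.\<close>
    have "gr_elem A ?n y = gr_elem A ?n (s \<otimes> xpow A \<gamma>)"
      using diff[OF s filt_closed[OF h]] h y by (subst gr_elem_eq_iff[OF yc scl[OF s]]) simp
    then have "gr_elem A ?n y = gr_elem A 0 s \<otimes>\<^bsub>gr A\<^esub> xpow (gr A) \<gamma> \<oplus>\<^bsub>gr A\<^esub> \<zero>\<^bsub>gr A\<^esub>"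
      using gr_elem_carrier[OF filt_monomial[OF s \<gamma>]] by (simp add: gr_monomial[OF one s \<gamma>])
    then show "gr_elem A 0 s \<in> base (gr A) \<and> (\<exists>p\<in>carrier (gr A).
      gr_elem A ?n y = gr_elem A 0 s \<otimes>\<^bsub>gr A\<^esub> xpow (gr A) \<gamma> \<oplus>\<^bsub>gr A\<^esub> p \<and>
      (p = \<zero>\<^bsub>gr A\<^esub> \<or> pdeg (gr A) p < exp_size (gr A) \<gamma>))"
      using s gr.zero_closed by (auto simp: gr_base)
    fix s' assume "s' \<in> base (gr A) \<and> (\<exists>p\<in>carrier (gr A).
      gr_elem A ?n y = s' \<otimes>\<^bsub>gr A\<^esub> xpow (gr A) \<gamma> \<oplus>\<^bsub>gr A\<^esub> p \<and>
      (p = \<zero>\<^bsub>gr A\<^esub> \<or> pdeg (gr A) p < exp_size (gr A) \<gamma>))"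
    then obtain r p where r: "r \<in> base A" "s' = gr_elem A 0 r" and p: "p \<in> carrier (gr A)"
        "p = \<zero>\<^bsub>gr A\<^esub> \<or> pdeg (gr A) p < ?n"
      and eq: "gr_elem A ?n y = gr_elem A 0 r \<otimes>\<^bsub>gr A\<^esub> xpow (gr A) \<gamma> \<oplus>\<^bsub>gr A\<^esub> p"
      by (auto simp: gr_base)
    \<comment> \<open>For a competing decomposition, component \<open>?n\<close> is compared: the
      remainder \<open>p\<close> contributes the trivial coset there, which brings the equation back
      to A modulo F_{n-1}.\<close>
    have "filt A (int ?n - 1) +> y = (filt A (int ?n - 1) +> r \<otimes> xpow A \<gamma>) <+> (filt A (int ?n - 1) +> \<zero>)"
      using fun_cong[OF eq, of ?n] gr_low_component[OF one p]
      by (simp add: gr_add gr_monomial[OF one r(1) \<gamma>] gr_elem_apply)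
    also have "\<dots> = filt A (int ?n - 1) +> r \<otimes> xpow A \<gamma>"
      using scl[OF r(1)] by (subst coset_add) auto
    finally have "y \<ominus> r \<otimes> xpow A \<gamma> \<in> filt A (int ?n - 1)"
      using coset_eq_iff[OF yc scl[OF r(1)]] by simp
    then show "s' = gr_elem A 0 s"
      using coeff_of_mod_filt[OF yc r(1) \<gamma>] ys r(2) by simp
  qed
qed

lemma gr_sigma:
  assumes one: "\<one> \<noteq> \<zero>" and \<alpha>: "\<alpha> \<in> exponents A" and r: "r \<in> base A"
  shows sigma_base: "sigma A \<alpha> r \<in> base A"
    and "sigma (gr A) \<alpha> (gr_elem A 0 r) = gr_elem A 0 (sigma A \<alpha> r)"
proof -
  \<comment> \<open>\<open>r\<close> is read as \<open>r x^0\<close>, so that the product formula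
    for monomials applies.\<close>
  have z: "exp_add \<alpha> (\<lambda>_. 0) = \<alpha>" by (simp add: exp_add_def)
  have "r \<otimes> xpow A (\<lambda>_. 0) = r" using base_closed[OF r] by (simp add: xpow_zero)
  then obtain s h where s: "s \<in> base A" and h: "h \<in> filt A (int (exp_size A \<alpha>) - 1)"
      and y: "xpow A \<alpha> \<otimes> r = s \<otimes> xpow A \<alpha> \<oplus> h"
    using xpow_mult_monomial[OF \<alpha> zero_exponents r] unfolding z by auto
  have "xpow (gr A) \<alpha> \<otimes>\<^bsub>gr A\<^esub> gr_elem A 0 r = gr_elem A (exp_size A \<alpha>) (xpow A \<alpha> \<otimes> r)"
    using gr_elem_mult[of "xpow A \<alpha>" "exp_size A \<alpha>" r 0] r \<alpha> one
    by (simp add: gr_xpow filt_xpow filt_0)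
  then show "sigma A \<alpha> r \<in> base A"
    "sigma (gr A) \<alpha> (gr_elem A 0 r) = gr_elem A 0 (sigma A \<alpha> r)"
    using lead_coeff_eq[OF \<alpha> s h y] gr_lead_coeff_eq[OF \<alpha> s h y one] s
    by (simp_all add: sigma_eq_lead_coeff)
qed

lemma gr_cmul:
  assumes one: "\<one> \<noteq> \<zero>" and \<alpha>: "\<alpha> \<in> exponents A" and \<beta>: "\<beta> \<in> exponents A"
  shows cmul_base: "cmul A \<alpha> \<beta> \<in> base A"
    and "cmul (gr A) \<alpha> \<beta> = gr_elem A 0 (cmul A \<alpha> \<beta>)"
proof -
  obtain s h where s: "s \<in> base A" and h: "h \<in> filt A (int (exp_size A (exp_add \<alpha> \<beta>)) - 1)"
      and y: "xpow A \<alpha> \<otimes> xpow A \<beta> = s \<otimes> xpow A (exp_add \<alpha> \<beta>) \<oplus> h"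
    using xpow_mult_monomial[OF \<alpha> \<beta> base_one] xpow_closed by auto
  note e = exp_add_exponents[OF \<alpha> \<beta>]
  have "xpow (gr A) \<alpha> \<otimes>\<^bsub>gr A\<^esub> xpow (gr A) \<beta> =
      gr_elem A (exp_size A (exp_add \<alpha> \<beta>)) (xpow A \<alpha> \<otimes> xpow A \<beta>)"
    using \<alpha> \<beta> one by (simp add: gr_xpow gr_elem_mult filt_xpow exp_size_add)
  then show "cmul A \<alpha> \<beta> \<in> base A" "cmul (gr A) \<alpha> \<beta> = gr_elem A 0 (cmul A \<alpha> \<beta>)"
    using lead_coeff_eq[OF e s h y] gr_lead_coeff_eq[OF e s h y one] s
    by (simp_all add: cmul_eq_lead_coeff)
qed

section \<open>Left ideals of R and of its copy in Gr(A)\<close>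

lemma left_ideal_gr_base:
  assumes L: "left_ideal L (A\<lparr>carrier := base A\<rparr>)"
  shows "left_ideal (gr_elem A 0 ` L) (gr A\<lparr>carrier := base (gr A)\<rparr>)"
proof -
  have sub: "L \<subseteq> base A" and add: "\<And>a b. a \<in> L \<Longrightarrow> b \<in> L \<Longrightarrow> a \<oplus> b \<in> L" and zero: "\<zero> \<in> L"
    using L by (auto simp: left_ideal_def additive_subgroup_def subgroup_def)
  have mult: "\<And>a b. a \<in> base A \<Longrightarrow> b \<in> L \<Longrightarrow> a \<otimes> b \<in> L" using L by (simp add: left_ideal_def)
  have Lc: "a \<in> carrier A" if "a \<in> L" for a using that sub base_closed by blast
  \<comment> \<open>Closure of \<open>L\<close> under inverses refers to the additive monoid
    restricted to R, while \<open>\<ominus>\<close> is the negative in A; writing it as (-1) a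
    bridges the two.\<close>
  have neg: "\<ominus> a \<in> L" if "a \<in> L" for a
    using mult[OF base_minus[OF base_one] that] Lc[OF that] by (simp add: l_minus)
  have z: "gr_elem A 0 \<zero> = \<zero>\<^bsub>gr A\<^esub>" by (simp add: gr_elem_eq_zero_iff filt_zero)
  \<comment> \<open>The inverse is a definite description over the restricted carrier, so it is
    evaluated directly; uniqueness holds because a competitor is the class of some \<open>b\<close>
    in R with \<open>b + a = 0\<close>.\<close>
  have inv: "inv\<^bsub>add_monoid (gr A\<lparr>carrier := base (gr A)\<rparr>)\<^esub> (gr_elem A 0 a) = gr_elem A 0 (\<ominus> a)"
    if a: "a \<in> L" for a
    unfolding m_inv_def
  proof (rule the_equality, goal_cases)
    case 1
    show ?case
      using Lc[OF a] neg[OF a] sub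
      by (auto simp: gr_base gr_elem_add r_neg l_neg z)
  next
    case (2 u)
    then obtain b where b: "b \<in> base A" "u = gr_elem A 0 b" by (auto simp: gr_base)
    with 2 have "gr_elem A 0 (b \<oplus> a) = \<zero>\<^bsub>gr A\<^esub>"
      using Lc[OF a] base_closed by (simp add: gr_elem_add)
    moreover have "b \<oplus> a \<in> base A" using base_add b(1) a sub by auto
    ultimately have "b \<oplus> a = \<zero>" using gr_elem_0_eq_zero_iff by blast
    then have "b = \<ominus> a" using Lc[OF a] base_closed[OF b(1)] minus_equality by force
    then show ?case using b(2) by simp
  qed
  have "subgroup (gr_elem A 0 ` L) (add_monoid (gr A\<lparr>carrier := base (gr A)\<rparr>))"
  proof (rule subgroup.intro)
    show "gr_elem A 0 ` L \<subseteq> carrier (add_monoid (gr A\<lparr>carrier := base (gr A)\<rparr>))"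
      using sub by (auto simp: gr_base)
    show "\<one>\<^bsub>add_monoid (gr A\<lparr>carrier := base (gr A)\<rparr>)\<^esub> \<in> gr_elem A 0 ` L"
      using image_eqI[where f = "gr_elem A 0", OF z[symmetric] zero] by simp
  next
    fix x y assume "x \<in> gr_elem A 0 ` L" "y \<in> gr_elem A 0 ` L"
    then show "x \<otimes>\<^bsub>add_monoid (gr A\<lparr>carrier := base (gr A)\<rparr>)\<^esub> y \<in> gr_elem A 0 ` L"
      using add Lc by (auto simp: gr_elem_add)
  next
    fix x assume "x \<in> gr_elem A 0 ` L"
    then show "inv\<^bsub>add_monoid (gr A\<lparr>carrier := base (gr A)\<rparr>)\<^esub> x \<in> gr_elem A 0 ` L"
      using inv neg by auto
  qed
  moreover have "gr_elem A 0 a \<otimes>\<^bsub>gr A\<^esub> gr_elem A 0 b \<in> gr_elem A 0 ` L"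
    if "a \<in> base A" "b \<in> L" for a b
    using gr_elem_mult[of a 0 b 0] mult[OF that] that sub by (auto simp: filt_0)
  ultimately show ?thesis by (auto simp: left_ideal_def additive_subgroup_def gr_base)
qed

text \<open>Each left ideal \<open>L\<close> of R containing \<open>S\<close> has as image a left
  ideal containing the image of \<open>S\<close>, hence the class of \<open>r\<close>; injectivity
  pulls this back to \<open>r\<close> in \<open>L\<close>.\<close>

lemma gen_left_ideal_gr_base:
  assumes "r \<in> base A"
    and "gr_elem A 0 r \<in> gen_left_ideal (gr A\<lparr>carrier := base (gr A)\<rparr>) (gr_elem A 0 ` S)"
  shows "r \<in> gen_left_ideal (A\<lparr>carrier := base A\<rparr>) S"
  unfolding gen_left_ideal_def
proof (intro InterI, clarify)
  fix L assume L: "left_ideal L (A\<lparr>carrier := base A\<rparr>)" "S \<subseteq> L"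
  then have "gr_elem A 0 r \<in> gr_elem A 0 ` L"
    using assms(2) left_ideal_gr_base[OF L(1)] unfolding gen_left_ideal_def by blast
  moreover have "L \<subseteq> base A"
    using L by (auto simp: left_ideal_def additive_subgroup_def subgroup_def)
  ultimately show "r \<in> L" using gr_elem_0_eq_iff assms(1) by auto
qed

text \<open>The number of reducers and the exponents \<open>\<alpha> j\<close> are kept; each
  \<open>u j\<close> is replaced by a preimage in \<open>G\<close>, and the generators over Gr(A)
  are the images of those over A.\<close>

lemma reducible_wrt_symbol:
  assumes one: "\<one> \<noteq> \<zero>" and mo: "monomial_order A ord"
    and f: "f \<in> carrier A" "f \<noteq> \<zero>" and G: "G \<subseteq> carrier A - {\<zero>}"
    and red: "reducible_wrt (gr A) (gr_order A ord) (symbol A ` G) (symbol A f)"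
  shows "reducible_wrt A ord G f"
proof -
  let ?o = "gr_order A ord"
  from red obtain t :: nat and u \<alpha> where
    u: "\<forall>j\<in>{1..t}. u j \<in> symbol A ` G \<and> \<alpha> j \<in> exponents (gr A) \<and>
      exp_add (\<alpha> j) (mon_exp (gr A) (lm (gr A) ?o (u j))) = mon_exp (gr A) (lm (gr A) ?o (symbol A f))"
    and lc: "lc (gr A) ?o (symbol A f) \<in> gen_left_ideal (gr A\<lparr>carrier := base (gr A)\<rparr>)
      {sigma (gr A) (\<alpha> j) (lc (gr A) ?o (u j)) \<otimes>\<^bsub>gr A\<^esub>
        cmul (gr A) (\<alpha> j) (mon_exp (gr A) (lm (gr A) ?o (u j))) |j. j \<in> {1..t}}"
    unfolding reducible_wrt_def by blast
  from u have "\<forall>j\<in>{1..t}. \<exists>g\<in>G. u j = symbol A g" by blast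
  then obtain g where g: "\<And>j. j \<in> {1..t} \<Longrightarrow> g j \<in> G \<and> u j = symbol A (g j)" by metis
  have gc: "g j \<in> carrier A" "g j \<noteq> \<zero>" if "j \<in> {1..t}" for j using g[OF that] G by auto
  note lt = leading_terms[OF one mo]
  have coeff: "sigma (gr A) (\<alpha> j) (lc (gr A) ?o (u j)) \<otimes>\<^bsub>gr A\<^esub>
        cmul (gr A) (\<alpha> j) (mon_exp (gr A) (lm (gr A) ?o (u j))) =
      gr_elem A 0 (sigma A (\<alpha> j) (lc A ord (g j)) \<otimes> cmul A (\<alpha> j) (mon_exp A (lm A ord (g j))))"
    if j: "j \<in> {1..t}" for j
  proof -
    have \<alpha>: "\<alpha> j \<in> exponents A" using u j by simp
    note * = gr_sigma[OF one \<alpha> lt(2)[OF gc[OF j]]] gr_cmul[OF one \<alpha> lt(1)[OF gc[OF j]]]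
    show ?thesis
      using * gr_elem_mult[of _ 0 _ 0] lt(3,4)[OF gc[OF j]] g[OF j] by (simp add: filt_0)
  qed
  let ?S = "{sigma A (\<alpha> j) (lc A ord (g j)) \<otimes> cmul A (\<alpha> j) (mon_exp A (lm A ord (g j))) |j. j \<in> {1..t}}"
  have "{sigma (gr A) (\<alpha> j) (lc (gr A) ?o (u j)) \<otimes>\<^bsub>gr A\<^esub>
        cmul (gr A) (\<alpha> j) (mon_exp (gr A) (lm (gr A) ?o (u j))) |j. j \<in> {1..t}} = gr_elem A 0 ` ?S"
    using coeff by (auto simp: image_iff) metis+
  with lc have "gr_elem A 0 (lc A ord f) \<in>
      gen_left_ideal (gr A\<lparr>carrier := base (gr A)\<rparr>) (gr_elem A 0 ` ?S)"
    using lt(4)[OF f] by simp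
  then have "lc A ord f \<in> gen_left_ideal (A\<lparr>carrier := base A\<rparr>) ?S"
    by (rule gen_left_ideal_gr_base[OF lt(2)[OF f]])
  moreover have "\<forall>j\<in>{1..t}. g j \<in> G \<and> \<alpha> j \<in> exponents A \<and>
      exp_add (\<alpha> j) (mon_exp A (lm A ord (g j))) = mon_exp A (lm A ord f)"
    using u g lt(3)[OF f] lt(3)[OF gc] by auto
  ultimately show ?thesis unfolding reducible_wrt_def by blast
qed

lemma symbol_gr_ideal:
  assumes I: "left_ideal I A" and f: "f \<in> I"
  shows "symbol A f \<in> gr_ideal A I"
proof -
  have sub: "I \<subseteq> carrier A" and zero: "\<zero> \<in> I"
    using I by (auto simp: left_ideal_def additive_subgroup_def subgroup_def)
  have "a \<in> I <+>\<^bsub>A\<^esub> filt A p" if "a \<in> I" for a p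
    using that sub filt_zero[of p] by (force simp: set_add_def')
  \<comment> \<open>In the degree of \<open>f\<close> the representative is \<open>f\<close>,
    elsewhere it is zero; both belong to \<open>I\<close>.\<close>
  then have "symbol A f q \<in> (\<lambda>f. filt A (int q - 1) +> f) `
      ((I <+>\<^bsub>A\<^esub> filt A (int q - 1)) \<inter> filt A (int q))" for q
    unfolding symbol_eq_gr_elem gr_elem_apply
    using f zero pdeg_filt[of f] sub filt_zero by (intro imageI) auto
  then show ?thesis using symbol_closed f sub by (auto simp: gr_ideal_def)
qed

end

theorem theorem3p14:
  fixes A :: "('a, 'm) pbw_scheme"
    and ord :: "'a rel"
    and I :: "'a set"
    and J :: "'j set"
    and G :: "'j \<Rightarrow> nat \<Rightarrow> 'a set"
    and g :: "'j \<Rightarrow> 'a"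
  assumes "skew_PBW A"
    and "monomial_order A ord"
    and "left_ideal I A" and "I \<noteq> {\<zero>\<^bsub>A\<^esub>}"
    and "finite J"
    and "groebner_basis (gr A) (gr_order A ord) (gr_ideal A I) (G ` J)"
    and "\<And>j. j \<in> J \<Longrightarrow> homogeneous A (G j)"
    and "\<And>j. j \<in> J \<Longrightarrow> g j \<in> I \<and> symbol A (g j) = G j"
  shows "groebner_basis A ord I (g ` J)"
proof -
  interpret skew_PBW A by (rule assms(1))
  have sub: "I \<subseteq> carrier A" and zero: "\<zero>\<^bsub>A\<^esub> \<in> I"
    using assms(3) by (auto simp: left_ideal_def additive_subgroup_def subgroup_def)
  \<comment> \<open>In the trivial ring the only left ideal is zero.\<close>
  have one: "\<one>\<^bsub>A\<^esub> \<noteq> \<zero>\<^bsub>A\<^esub>"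
  proof
    assume "\<one>\<^bsub>A\<^esub> = \<zero>\<^bsub>A\<^esub>"
    then have "carrier A = {\<zero>\<^bsub>A\<^esub>}" by (rule one_zeroD)
    then show False using sub zero assms(4) by auto
  qed
  have gb: "finite (G ` J)" "G ` J \<noteq> {}" "G ` J \<subseteq> gr_ideal A I - {\<zero>\<^bsub>gr A\<^esub>}"
    "\<And>u. u \<in> gr_ideal A I - {\<zero>\<^bsub>gr A\<^esub>} \<Longrightarrow> reducible_wrt (gr A) (gr_order A ord) (G ` J) u"
    using assms(6) by (auto simp: groebner_basis_def)
  have sym: "symbol A ` g ` J = G ` J" using assms(8) by (auto simp: image_iff)
  \<comment> \<open>If some \<open>g j\<close> were zero, its symbol would be the zero of Gr(A),
    which a Groebner basis does not contain.\<close>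
  have nz: "g ` J \<subseteq> I - {\<zero>\<^bsub>A\<^esub>}"
    using assms(8) gb(3) symbol_eq_zero_iff[OF zero_closed] by fastforce
  have "reducible_wrt A ord (g ` J) f" if "f \<in> I - {\<zero>\<^bsub>A\<^esub>}" for f
  proof (rule reducible_wrt_symbol[OF one assms(2)])
    show f: "f \<in> carrier A" "f \<noteq> \<zero>\<^bsub>A\<^esub>" using that sub by auto
    show "g ` J \<subseteq> carrier A - {\<zero>\<^bsub>A\<^esub>}" using nz sub by blast
    show "reducible_wrt (gr A) (gr_order A ord) (symbol A ` g ` J) (symbol A f)"
      unfolding sym using gb(4) symbol_gr_ideal[OF assms(3)] symbol_eq_zero_iff f that by auto
  qed
  then show ?thesis using assms(5) gb(2) nz by (auto simp: groebner_basis_def)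
qed

end
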